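(* There exists a compact metrizable recurrent-transitive $\mathbb{Z}$-dynamical system $(T,X)$ which is LE but not HAE.
   Context: A compact metrizable $\mathbb Z$-dynamical system (cascade) $(T,X)$ is a compact metric space $(X,d)$ with a homeomorphism $T:X\to X$. A point $x$ is transitive if its orbit $\{T^nx:n\in\mathbb Z\}$ is dense, and recurrent if $x=\lim T^{n_i}x$ for some net of integers with $|n_i|\to\infty$. The system is recurrent-transitive if it has a point that is both recurrent and transitive. For a closed $T$-invariant $Y\subset X$, a point $x_0\in Y$ is a point of equicontinuity of $Y$ if for every $\varepsilon>0$ there is a neighborhood $U$ of $x_0$ in $Y$ with $d(T^nx_0,T^nx)<\varepsilon$ for all $x\in U$, $n\in\mathbb Z$. $Y$ is almost equicontinuous (AE) if its points of equicontinuity are dense in $Y$. $(T,X)$ is hereditarily almost equicontinuous (HAE) if every closed invariant $Y\subset X$ is AE. $(T,X)$ is locally equicontinuous (LE) if every $x_0\in X$ is a point of equicontinuity of its orbit closure $\overline{\{T^nx_0:n\in\mathbb Z\}}$. *)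

theory Defs
  imports "HOL-Analysis.Analysis"
begin

text \<open>For existence statements about cascades, the carrier type \<open>nat \<Rightarrow> real\<close> loses no generality: every compact metric space has at most
  continuum many points, and the metric \<open>d\<close> on the carrier set \<open>X\<close> is arbitrary.\<close>

locale cascade = Metric_space X d for X :: "'a set" and d +
  fixes T :: "'a \<Rightarrow> 'a"
  assumes compact: "compact_space mtopology"
    and homeo: "homeomorphic_map mtopology mtopology T"
begin

text \<open>Integer powers of the homeomorphism; only the values on the carrier \<open>X\<close> matter,
  so negative powers use the inverse of \<open>T\<close> restricted to \<open>X\<close>.\<close>

definition zpow :: "int \<Rightarrow> 'a \<Rightarrow> 'a" where
  "zpow n = (if n \<ge> 0 then T ^^ nat n else inv_into X T ^^ nat (- n))"

definition orbit :: "'a \<Rightarrow> 'a set" where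
  "orbit x = range (\<lambda>n. zpow n x)"

definition transitive_point :: "'a \<Rightarrow> bool" where
  "transitive_point x \<longleftrightarrow> x \<in> X \<and> mtopology closure_of orbit x = X"

text \<open>A net of integers is represented by its eventuality filter on \<open>int\<close>; every proper filter
  on \<open>int\<close> arises from a net in this way.\<close>

definition recurrent_point :: "'a \<Rightarrow> bool" where
  "recurrent_point x \<longleftrightarrow> x \<in> X \<and>
    (\<exists>F :: int filter. F \<noteq> bot \<and> filterlim (\<lambda>n. \<bar>n\<bar>) at_top F \<and>
       limitin mtopology (\<lambda>n. zpow n x) x F)"

definition recurrent_transitive :: bool where
  "recurrent_transitive \<longleftrightarrow> (\<exists>x. recurrent_point x \<and> transitive_point x)"

text \<open>Invariance is meant under the whole \<open>\<int>\<close>-action, i.e. under \<open>T\<close> and its inverse; for subsets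
  of \<open>X\<close> this is \<open>T ` Y = Y\<close>.\<close>

definition closed_invariant :: "'a set \<Rightarrow> bool" where
  "closed_invariant Y \<longleftrightarrow> closedin mtopology Y \<and> T ` Y = Y"

definition equicontinuity_point :: "'a set \<Rightarrow> 'a \<Rightarrow> bool" where
  "equicontinuity_point Y x0 \<longleftrightarrow> x0 \<in> Y \<and>
    (\<forall>\<epsilon>>0. \<exists>U. openin (subtopology mtopology Y) U \<and> x0 \<in> U \<and>
       (\<forall>x\<in>U. \<forall>n. d (zpow n x0) (zpow n x) < \<epsilon>))"

definition almost_equicontinuous :: "'a set \<Rightarrow> bool" where
  "almost_equicontinuous Y \<longleftrightarrow> Y \<subseteq> mtopology closure_of {x. equicontinuity_point Y x}"

definition hereditarily_almost_equicontinuous :: bool where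
  "hereditarily_almost_equicontinuous \<longleftrightarrow>
    (\<forall>Y. closed_invariant Y \<longrightarrow> almost_equicontinuous Y)"

definition locally_equicontinuous :: bool where
  "locally_equicontinuous \<longleftrightarrow>
    (\<forall>x0\<in>X. equicontinuity_point (mtopology closure_of orbit x0) x0)"

end

end

theory Submission
  imports Defs
begin

text \<open>
  The space is the closure of one shift orbit. Its base point is a sequence indexed by \<open>\<int>\<close> whose
  entries depend on \<open>n\<close> only through quantities that are Lipschitz for a group norm \<open>weight\<close> on
  \<open>\<int>\<close>, and the norm is itself one of those quantities.

  \<^item> With \<open>\<chi>\<^sub>k n = exp (2\<pi>i n / 2\<^bsup>k\<^sup>2\<^esup>)\<close> the norm is \<open>weight n = \<Sum>k. 2\<^bsup>k\<^esup> * \<bar>\<chi>\<^sub>k n - 1\<bar>\<close>. The moduli grow so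
    fast that the sum converges and that \<open>weight (2\<^bsup>j\<^sup>2\<^esup>)\<close> tends to 0, while \<open>weight\<close> is unbounded on
    every subgroup generated by some \<open>2\<^bsup>j\<^sup>2\<^esup>\<close>. Translation by \<open>2\<^bsup>j\<^sup>2\<^esup>\<close> therefore nearly fixes the whole
    base point uniformly, which gives recurrence.

  \<^item> The entries at \<open>n\<close> are \<open>1 / (1 + weight n)\<close>, all \<open>\<chi>\<^sub>k n\<close>, and a wave. The wave is a product of the
    characters \<open>\<chi>\<^sub>k\<close> for \<open>k\<close> in a finite set \<open>A\<close>, multiplied by an amplitude. Amplitude and \<open>A\<close> depend on
    \<open>n\<close> through \<open>ln (1 + weight n)\<close>: the set \<open>A\<close> is constant while this number stays between two
    consecutive integers, and the amplitude vanishes at integers, so that the change of \<open>A\<close> does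
    not destroy the Lipschitz bound. Every finite set is used infinitely often.

  A point of the closure is a limit of translates by integers \<open>m i\<close>, and local equicontinuity is
  proved according to whether \<open>weight (m i)\<close> stays bounded. If it does, the limits of
  \<open>1 / (1 + weight)\<close> and of the \<open>\<chi>\<^sub>k\<close> still determine the norm: whenever translation by \<open>n\<close> returns the
  point close to itself, \<open>weight n\<close> is small (\<open>near_point_return_weight\<close>), and then by the Lipschitz
  bound the return is uniform along the orbit. If \<open>weight (m i)\<close> tends to infinity, then
  \<open>ln (1 + weight)\<close> varies arbitrarily slowly near \<open>m i\<close>, the wave becomes a genuine rotation, and
  the flow is isometric along the orbit of the limit point (\<open>far_point_isometry\<close>).

  Hereditary almost equicontinuity fails among the points at infinity. For each finite \<open>A\<close> there is
  one on which the wave is exactly \<open>\<Prod>k\<in>A. \<chi>\<^sub>k n\<close> (\<open>far_approximation\<close>). Adding a large \<open>k\<close> to \<open>A\<close> changes this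
  point very little in any fixed window, but at position \<open>2\<^bsup>k\<^sup>2 - 1\<^esup>\<close> the extra factor is \<open>-1\<close>. Hence in the
  closed set generated by these points the flow is sensitive everywhere, although it is a
  rotation on each single orbit.
\<close>

section \<open>Compact flows over the integers\<close>

text \<open>
  Working with the whole family of iterates avoids inverse functions restricted to the carrier;
  \<open>zpow_flow\<close> identifies the two descriptions.
\<close>

locale integer_flow =
  fixes \<Phi> :: "int \<Rightarrow> 'a::metric_space \<Rightarrow> 'a"
  assumes flow_zero: "\<Phi> 0 x = x"
    and flow_add: "\<Phi> (m + n) x = \<Phi> m (\<Phi> n x)"
    and flow_continuous: "continuous_on UNIV (\<Phi> n)"
begin

definition traj :: "'a \<Rightarrow> 'a set" where
  "traj x = range (\<lambda>n. \<Phi> n x)"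

lemma flow_inverse [simp]: "\<Phi> n (\<Phi> (- n) x) = x" "\<Phi> (- n) (\<Phi> n x) = x"
  by (simp_all flip: flow_add add: flow_zero)

lemma flow_tendsto: "(f \<longlongrightarrow> x) F \<Longrightarrow> ((\<lambda>i. \<Phi> n (f i)) \<longlongrightarrow> \<Phi> n x) F"
  using flow_continuous by (rule continuous_on_tendsto_compose) auto

lemma flow_closure: "x \<in> closure S \<Longrightarrow> (\<And>y. y \<in> S \<Longrightarrow> \<Phi> n y \<in> S) \<Longrightarrow> \<Phi> n x \<in> closure S"
  by (metis closure_sequential flow_tendsto)

lemma traj_invariant: "y \<in> traj x \<Longrightarrow> \<Phi> n y \<in> traj x"
  by (auto simp: traj_def simp flip: flow_add)

lemma self_in_traj: "x \<in> traj x"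
  unfolding traj_def by (metis flow_zero rangeI)

end

lemma mtopology_dist: "Metric_space.mtopology X dist = top_of_set X"
proof -
  interpret Submetric UNIV dist X by unfold_locales auto
  show ?thesis
    using mtopology_submetric by simp
qed

locale compact_integer_flow = integer_flow \<Phi> for \<Phi> :: "int \<Rightarrow> 'a::metric_space \<Rightarrow> 'a" +
  fixes X :: "'a set"
  assumes compact_carrier: "compact X"
    and invariant: "x \<in> X \<Longrightarrow> \<Phi> n x \<in> X"
begin

lemma closure_of_carrier: "S \<subseteq> X \<Longrightarrow> top_of_set X closure_of S = closure S"
  using closure_minimal[of S X] compact_imp_closed[OF compact_carrier]
  by (simp add: closure_of_subtopology inf.absorb2)

sublocale cascade X dist "\<Phi> 1"
proof -
  interpret Metric_space X dist
    by unfold_locales (auto simp: dist_commute dist_triangle)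
  have c: "continuous_map (top_of_set X) (top_of_set X) (\<Phi> n)" for n
    using continuous_on_subset[OF flow_continuous] invariant by auto
  have "homeomorphic_maps (top_of_set X) (top_of_set X) (\<Phi> 1) (\<Phi> (-1))"
    using c flow_inverse[of 1] by (auto simp: homeomorphic_maps_def)
  then show "cascade X dist (\<Phi> 1)"
    using compact_carrier
    by unfold_locales (auto simp: mtopology_dist homeomorphic_map_maps compact_space_subtopology)
qed

lemma inv_into_flow: "x \<in> X \<Longrightarrow> inv_into X (\<Phi> 1) x = \<Phi> (-1) x"
proof (rule inv_into_f_eq)
  show "inj_on (\<Phi> 1) X" by (metis flow_inverse(2) inj_onI)
qed (auto simp: invariant)

lemma zpow_flow: "x \<in> X \<Longrightarrow> zpow n x = \<Phi> n x"
proof -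
  assume x: "x \<in> X"
  have pos: "(\<Phi> 1 ^^ k) x = \<Phi> (int k) x" for k
    by (induction k) (auto simp: flow_zero simp flip: flow_add)
  have neg: "(inv_into X (\<Phi> 1) ^^ k) x = \<Phi> (- int k) x" for k
    by (induction k) (auto simp: flow_zero inv_into_flow invariant x simp flip: flow_add)
  show ?thesis
    using pos[of "nat n"] neg[of "nat (-n)"] by (auto simp: zpow_def)
qed

lemma orbit_flow: "x \<in> X \<Longrightarrow> orbit x = traj x"
  by (simp add: orbit_def traj_def zpow_flow)

lemma traj_subset: "x \<in> X \<Longrightarrow> traj x \<subseteq> X"
  by (auto simp: traj_def invariant)

lemma recurrent_transitiveI:
  assumes X: "X = closure (traj x)"
    and lim: "filterlim r at_top sequentially" "(\<lambda>i. \<Phi> (r i) x) \<longlonglongrightarrow> x"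
  shows recurrent_transitive
proof -
  have x: "x \<in> X"
    using X self_in_traj closure_subset by auto
  have "transitive_point x"
    unfolding transitive_point_def mtopology_dist orbit_flow[OF x]
    using closure_of_carrier[OF traj_subset[OF x]] X x by auto
  moreover have "recurrent_point x"
    unfolding recurrent_point_def mtopology_dist
  proof (intro conjI exI)
    show "filtermap r sequentially \<noteq> bot"
      by (simp add: filtermap_bot_iff)
    show "filterlim (\<lambda>n. \<bar>n\<bar>) at_top (filtermap r sequentially)"
      unfolding filterlim_filtermap
      by (rule filterlim_at_top_mono[OF lim(1)]) (intro always_eventually allI abs_ge_self)
    show "limitin (top_of_set X) (\<lambda>n. zpow n x) x (filtermap r sequentially)"
      using lim(2) x by (auto simp: zpow_flow limitin_subtopology filterlim_filtermap invariant)
  qed (rule x)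
  ultimately show ?thesis
    by (auto simp: recurrent_transitive_def)
qed

text \<open>
  Equicontinuity at \<open>x\<close> inside its own orbit closure can be tested on the dense orbit alone: the
  estimate for points \<open>\<Phi> n x\<close> close to \<open>x\<close> passes to their limits because each \<open>\<Phi> a\<close> is continuous.
\<close>

lemma equicontinuity_point_orbit_closureI:
  assumes x: "x \<in> X"
    and ret: "\<And>\<epsilon>. \<epsilon> > 0 \<Longrightarrow> \<exists>\<delta>>0. \<forall>n. dist (\<Phi> n x) x < \<delta> \<longrightarrow> (\<forall>a. dist (\<Phi> (a + n) x) (\<Phi> a x) \<le> \<epsilon>)"
  shows "equicontinuity_point (mtopology closure_of orbit x) x"
proof -
  let ?Y = "closure (traj x)"
  have sub: "?Y \<subseteq> X"
    using closure_minimal traj_subset[OF x] compact_imp_closed[OF compact_carrier] by blast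
  have Y: "mtopology closure_of orbit x = ?Y"
    by (simp add: mtopology_dist orbit_flow[OF x] closure_of_carrier traj_subset[OF x])
  have top: "subtopology mtopology ?Y = top_of_set ?Y"
    using sub by (simp add: mtopology_dist subtopology_subtopology inf.absorb2)
  show ?thesis
    unfolding Y equicontinuity_point_def top
  proof (intro conjI allI impI)
    show xY: "x \<in> ?Y"
      using self_in_traj closure_subset by auto
    fix \<epsilon> :: real assume "\<epsilon> > 0"
    then obtain \<delta> where \<delta>: "\<delta> > 0"
        "\<And>n a. dist (\<Phi> n x) x < \<delta> \<Longrightarrow> dist (\<Phi> (a + n) x) (\<Phi> a x) \<le> \<epsilon> / 2"
      using ret[of "\<epsilon> / 2"] by auto
    have "dist (zpow n x) (zpow n y) < \<epsilon>" if y: "y \<in> ?Y \<inter> ball x \<delta>" for y n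
    proof -
      obtain f where f: "\<And>i. f i \<in> traj x" "f \<longlonglongrightarrow> y"
        using y by (auto simp: closure_sequential)
      have "\<forall>i. \<exists>k. f i = \<Phi> k x"
        using f(1) by (auto simp: traj_def image_iff)
      then obtain k where k: "\<And>i. f i = \<Phi> (k i) x"
        by metis
      have "\<forall>\<^sub>F i in sequentially. f i \<in> ball x \<delta>"
        by (rule topological_tendstoD[OF f(2) open_ball]) (use y in auto)
      then have ev: "\<forall>\<^sub>F i in sequentially. dist (\<Phi> n x) (\<Phi> n (f i)) \<le> \<epsilon> / 2"
        by eventually_elim (use \<delta>(2) in \<open>simp add: k dist_commute flip: flow_add\<close>)
      have "(\<lambda>i. dist (\<Phi> n x) (\<Phi> n (f i))) \<longlonglongrightarrow> dist (\<Phi> n x) (\<Phi> n y)"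
        by (intro tendsto_dist tendsto_const flow_tendsto f(2))
      from tendsto_upperbound[OF this ev] have "dist (\<Phi> n x) (\<Phi> n y) \<le> \<epsilon> / 2"
        by simp
      then show ?thesis
        using \<open>\<epsilon> > 0\<close> x y sub by (auto simp: zpow_flow)
    qed
    then show "\<exists>U. openin (top_of_set ?Y) U \<and> x \<in> U \<and> (\<forall>y\<in>U. \<forall>n. dist (zpow n x) (zpow n y) < \<epsilon>)"
      using \<delta>(1) xY by (intro exI[of _ "?Y \<inter> ball x \<delta>"]) auto
  qed
qed

text \<open>
  Sensitivity on a dense invariant subset of \<open>closure A\<close> excludes equicontinuity at every point of
  the closure: a neighbourhood witnessing equicontinuity would contain a point \<open>a\<close> of \<open>A\<close> together
  with the nearby \<open>b\<close> from which it is separated by \<open>\<eta>\<close> at some time.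
\<close>

lemma not_hereditarily_almost_equicontinuousI:
  assumes A: "A \<subseteq> X" "A \<noteq> {}" "\<And>a n. a \<in> A \<Longrightarrow> \<Phi> n a \<in> A"
    and \<eta>: "\<eta> > 0"
    and sens: "\<And>a \<delta>. a \<in> A \<Longrightarrow> \<delta> > 0 \<Longrightarrow> \<exists>b\<in>A. dist a b < \<delta> \<and> (\<exists>n. dist (\<Phi> n a) (\<Phi> n b) \<ge> \<eta>)"
  shows "\<not> hereditarily_almost_equicontinuous"
proof -
  let ?Y = "closure A"
  have sub: "?Y \<subseteq> X"
    using closure_minimal A(1) compact_imp_closed[OF compact_carrier] by blast
  have top: "subtopology mtopology ?Y = top_of_set ?Y"
    using sub by (simp add: mtopology_dist subtopology_subtopology inf.absorb2)
  have inv: "\<Phi> n y \<in> ?Y" if "y \<in> ?Y" for y n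
    using that A(3) by (rule flow_closure)
  have "\<Phi> 1 ` ?Y = ?Y"
  proof
    show "?Y \<subseteq> \<Phi> 1 ` ?Y"
      using flow_inverse(1)[of 1] inv[of _ "-1"] by (metis imageI subsetI)
  qed (use inv in auto)
  then have inv_Y: "closed_invariant ?Y"
    unfolding closed_invariant_def mtopology_dist by (simp add: closed_subset sub)
  have "\<not> equicontinuity_point ?Y y" for y
  proof
    assume "equicontinuity_point ?Y y"
    then obtain U where yY: "y \<in> ?Y" and U: "openin (top_of_set ?Y) U" "y \<in> U"
        and close: "\<And>z n. z \<in> U \<Longrightarrow> dist (zpow n y) (zpow n z) < \<eta> / 2"
      unfolding equicontinuity_point_def top using \<eta> by (meson half_gt_zero)
    obtain a where a: "a \<in> A" "a \<in> U"
    proof -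
      obtain V where V: "open V" "U = ?Y \<inter> V"
        using U(1) by (auto simp: openin_open)
      then have "V \<inter> A \<noteq> {}"
        using U(2) open_Int_closure_eq_empty by fastforce
      then show ?thesis
        using V closure_subset that by blast
    qed
    obtain \<delta> where \<delta>: "\<delta> > 0" "ball a \<delta> \<inter> ?Y \<subseteq> U"
      using U(1) a(2) openin_contains_ball by metis
    obtain b n where b: "b \<in> A" "dist a b < \<delta>" "dist (\<Phi> n a) (\<Phi> n b) \<ge> \<eta>"
      using sens[OF a(1) \<delta>(1)] by blast
    have "b \<in> U"
      using b \<delta> closure_subset by (auto simp: subset_iff)
    have "dist (\<Phi> n y) (\<Phi> n a) < \<eta> / 2" "dist (\<Phi> n y) (\<Phi> n b) < \<eta> / 2"
      using close[OF a(2), of n] close[OF \<open>b \<in> U\<close>, of n] a(1) b(1) A(1) yY sub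
      by (auto simp: zpow_flow subset_iff)
    then show False
      using b(3) dist_triangle_half_r[of "\<Phi> n y" "\<Phi> n a" \<eta> "\<Phi> n b"] by (simp add: dist_commute)
  qed
  then have none: "Collect (equicontinuity_point ?Y) = {}"
    by auto
  show ?thesis
  proof
    assume hereditarily_almost_equicontinuous
    then have "?Y \<subseteq> mtopology closure_of Collect (equicontinuity_point ?Y)"
      using inv_Y by (auto simp: hereditarily_almost_equicontinuous_def almost_equicontinuous_def)
    then show False
      using A(2) by (simp add: none)
  qed
qed

end

section \<open>A group norm on the integers\<close>

definition char_circle :: "nat \<Rightarrow> int \<Rightarrow> complex" where
  "char_circle k n = cis (2 * pi * (of_int n / 2 ^ (k\<^sup>2)))"

lemma char_add: "char_circle k (m + n) = char_circle k m * char_circle k n"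
  by (simp add: char_circle_def cis_mult add_divide_distrib ring_distribs)

lemma norm_char [simp]: "cmod (char_circle k n) = 1"
  by (simp add: char_circle_def)

lemma char_zero [simp]: "char_circle k 0 = 1"
  by (simp add: char_circle_def)

lemma char_shift_diff: "cmod (char_circle k (m + n) - char_circle k m) = cmod (char_circle k n - 1)"
proof -
  have "char_circle k (m + n) - char_circle k m = char_circle k m * (char_circle k n - 1)"
    by (simp add: char_add ring_distribs)
  then show ?thesis by (simp add: norm_mult)
qed

lemma norm_cis_diff_le: "cmod (cis x - cis y) \<le> \<bar>x - y\<bar>"
proof -
  have "cmod (cis x - cis y) = cmod (cis (x - y) - 1)"
  proof -
    have "cis x - cis y = cis y * (cis (x - y) - 1)"
      by (simp add: ring_distribs cis_mult)
    then show ?thesis by (simp add: norm_mult)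
  qed
  also have "\<dots> \<le> \<bar>x - y\<bar>"
    using dist_exp_i_1[of "x - y"] abs_sin_x_le_abs_x[of "(x - y) / 2"] by (simp add: cis_conv_exp)
  finally show ?thesis .
qed

lemma char_eq_1: "2 ^ (k\<^sup>2) dvd n \<Longrightarrow> char_circle k n = 1"
proof -
  assume "2 ^ (k\<^sup>2) dvd n"
  then obtain l where "n = 2 ^ (k\<^sup>2) * l" ..
  then show ?thesis
    using cis_multiple_2pi[of "of_int l"] by (simp add: char_circle_def)
qed

lemma norm_char_minus_1_le: "cmod (char_circle k n - 1) \<le> 2 * pi * (\<bar>of_int n\<bar> / 2 ^ (k\<^sup>2))"
  using norm_cis_diff_le[of "2 * pi * (of_int n / 2 ^ (k\<^sup>2))" 0]
  by (simp add: char_circle_def abs_mult)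

lemma char_half: "k \<ge> 1 \<Longrightarrow> char_circle k (2 ^ (k\<^sup>2 - 1)) = - 1"
proof -
  assume "k \<ge> 1"
  then have "(2::real) ^ (k\<^sup>2) = 2 * 2 ^ (k\<^sup>2 - 1)"
    by (simp flip: power_Suc)
  then show ?thesis by (simp add: char_circle_def)
qed

definition seminorm_term :: "nat \<Rightarrow> int \<Rightarrow> real" where
  "seminorm_term k n = 2 ^ k * cmod (char_circle k n - 1)"

lemma seminorm_term_nonneg: "seminorm_term k n \<ge> 0"
  by (simp add: seminorm_term_def)

lemma seminorm_term_zero: "seminorm_term k 0 = 0"
  by (simp add: seminorm_term_def)

lemma seminorm_term_add_le: "seminorm_term k (m + n) \<le> seminorm_term k m + seminorm_term k n"
proof -
  have "cmod (char_circle k (m + n) - 1) \<le> cmod (char_circle k (m + n) - char_circle k m) + cmod (char_circle k m - 1)"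
    using norm_triangle_ineq[of "char_circle k (m + n) - char_circle k m" "char_circle k m - 1"] by simp
  then have "2 ^ k * cmod (char_circle k (m + n) - 1) \<le> 2 ^ k * (cmod (char_circle k n - 1) + cmod (char_circle k m - 1))"
    by (intro mult_left_mono) (auto simp: char_shift_diff)
  then show ?thesis
    by (simp add: seminorm_term_def ring_distribs)
qed

lemma seminorm_term_uminus: "seminorm_term k (- n) = seminorm_term k n"
  using char_shift_diff[of k n "- n"] by (simp add: seminorm_term_def norm_minus_commute)

lemma quotient_le_reciprocal: "a * a * b \<le> c * 2 \<Longrightarrow> 0 < a \<Longrightarrow> 0 < c \<Longrightarrow> a * b / c \<le> 2 * (1 / a)" for a b c :: real
  by (simp add: field_simps)

text \<open>
  The bound rests on \<open>2 * k \<le> k\<^sup>2 + 1\<close>: the modulus \<open>2 ^ k\<^sup>2\<close> outgrows the factor \<open>2 ^ k\<close> with another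
  factor of order \<open>2 ^ k\<close> to spare.
\<close>

lemma seminorm_term_le: "seminorm_term k n \<le> 4 * pi * \<bar>of_int n\<bar> * (1 / 2) ^ k"
proof -
  have "0 \<le> (real k - 1)\<^sup>2"
    by simp
  then have "real (2 * k) \<le> real (k\<^sup>2 + 1)"
    by (simp add: power2_diff)
  then have "2 * k \<le> k\<^sup>2 + 1"
    unfolding of_nat_le_iff .
  then have "(2::real) ^ (2 * k) \<le> 2 ^ (k\<^sup>2 + 1)"
    by (intro power_increasing) auto
  then have *: "2 ^ k / 2 ^ (k\<^sup>2) \<le> 2 * (1 / 2 :: real) ^ k"
    using quotient_le_reciprocal[of "2 ^ k" 1 "2 ^ (k\<^sup>2)"]
    by (simp only: power_add mult_2 power_one_over power_one_right mult_1_right zero_less_power zero_less_numeral)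
  have "seminorm_term k n \<le> 2 ^ k * (2 * pi * (\<bar>of_int n\<bar> / 2 ^ (k\<^sup>2)))"
    unfolding seminorm_term_def by (intro mult_left_mono norm_char_minus_1_le) auto
  also have "\<dots> = 2 * pi * \<bar>of_int n\<bar> * (2 ^ k / 2 ^ (k\<^sup>2))"
    by simp
  also have "\<dots> \<le> 2 * pi * \<bar>of_int n\<bar> * (2 * (1 / 2) ^ k)"
    by (intro mult_left_mono *) auto
  finally show ?thesis by simp
qed

lemma seminorm_term_summable: "summable (\<lambda>k. seminorm_term k n)"
proof (rule summable_comparison_test_ev)
  show "\<forall>\<^sub>F k in sequentially. norm (seminorm_term k n) \<le> 4 * pi * \<bar>of_int n\<bar> * (1 / 2) ^ k"
    using seminorm_term_le seminorm_term_nonneg by (auto intro!: always_eventually)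
  show "summable (\<lambda>k. 4 * pi * \<bar>real_of_int n\<bar> * (1 / 2) ^ k)"
    by (intro summable_mult summable_geometric) auto
qed

definition weight :: "int \<Rightarrow> real" where
  "weight n = (\<Sum>k. seminorm_term k n)"

lemma weight_nonneg: "weight n \<ge> 0"
  unfolding weight_def by (intro suminf_nonneg seminorm_term_summable seminorm_term_nonneg)

lemma weight_zero [simp]: "weight 0 = 0"
  by (simp add: weight_def seminorm_term_zero)

lemma weight_uminus: "weight (- n) = weight n"
  by (simp add: weight_def seminorm_term_uminus)

lemma weight_add_le: "weight (m + n) \<le> weight m + weight n"
  unfolding weight_def
  by (simp add: suminf_add seminorm_term_summable)
     (intro suminf_le summable_add seminorm_term_summable seminorm_term_add_le)

lemma weight_diff_le: "\<bar>weight (m + n) - weight m\<bar> \<le> weight n"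
  using weight_add_le[of m n] weight_add_le[of "m + n" "- n"] by (simp add: weight_uminus)

lemma sum_seminorm_term_le_weight: "finite A \<Longrightarrow> (\<Sum>k\<in>A. seminorm_term k n) \<le> weight n"
  unfolding weight_def by (intro sum_le_suminf seminorm_term_summable ballI seminorm_term_nonneg)

lemma sum_norm_char_le_weight:
  assumes "finite A" shows "(\<Sum>k\<in>A. cmod (char_circle k n - 1)) \<le> weight n"
proof -
  have "(\<Sum>k\<in>A. cmod (char_circle k n - 1)) \<le> (\<Sum>k\<in>A. seminorm_term k n)"
    by (intro sum_mono) (simp add: seminorm_term_def mult_le_cancel_right1)
  then show ?thesis
    using sum_seminorm_term_le_weight[OF assms, of n] by linarith
qed

text \<open>
  The terms with \<open>k \<le> j\<close> vanish because \<open>2 ^ k\<^sup>2\<close> divides \<open>2 ^ j\<^sup>2\<close>, and for larger \<open>k\<close> the quotient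
  \<open>2 ^ j\<^sup>2 / 2 ^ k\<^sup>2\<close> is small enough to absorb the factor \<open>2 ^ k\<close>.
\<close>

lemma weight_power_le: "weight (2 ^ (j\<^sup>2)) \<le> 8 * pi * (1 / 2) ^ j"
proof -
  have *: "seminorm_term (k + j) (2 ^ (j\<^sup>2)) \<le> 4 * pi * (1 / 2) ^ j * (1 / 2) ^ k" for k
  proof (cases "k = 0")
    case True
    then show ?thesis by (simp add: seminorm_term_def char_eq_1)
  next
    case False
    have "2 * (k + j) + j\<^sup>2 \<le> (k + j)\<^sup>2 + 1"
    proof -
      obtain l where "k = Suc l"
        using False not0_implies_Suc by blast
      then show ?thesis
        by (simp add: power2_eq_square algebra_simps)
    qed
    then have "(2::real) ^ (2 * (k + j) + j\<^sup>2) \<le> 2 ^ ((k + j)\<^sup>2 + 1)"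
      by (intro power_increasing) auto
    then have **: "2 ^ (k + j) * 2 ^ (j\<^sup>2) / 2 ^ ((k + j)\<^sup>2) \<le> 2 * (1 / 2 :: real) ^ (k + j)"
      using quotient_le_reciprocal[of "2 ^ (k + j)" "2 ^ (j\<^sup>2)" "2 ^ ((k + j)\<^sup>2)"]
      by (simp only: power_add[of _ "k + j" "k + j"] power_add[of _ "_ + _" "j\<^sup>2"] power_add[of _ _ 1] mult_2 power_one_over power_one_right zero_less_power zero_less_numeral)
    have "seminorm_term (k + j) (2 ^ (j\<^sup>2)) \<le> 2 ^ (k + j) * (2 * pi * (\<bar>of_int (2 ^ (j\<^sup>2))\<bar> / 2 ^ ((k + j)\<^sup>2)))"
      unfolding seminorm_term_def by (intro mult_left_mono norm_char_minus_1_le) auto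
    also have "\<dots> = 2 * pi * (2 ^ (k + j) * 2 ^ (j\<^sup>2) / 2 ^ ((k + j)\<^sup>2))"
      by simp
    also have "\<dots> \<le> 2 * pi * (2 * (1 / 2) ^ (k + j))"
      by (intro mult_left_mono **) auto
    finally show ?thesis by (simp add: power_add mult_ac)
  qed
  have "weight (2 ^ (j\<^sup>2)) = (\<Sum>k. seminorm_term (k + j) (2 ^ (j\<^sup>2))) + (\<Sum>k<j. seminorm_term k (2 ^ (j\<^sup>2)))"
    unfolding weight_def by (rule suminf_split_initial_segment[OF seminorm_term_summable])
  also have "(\<Sum>k<j. seminorm_term k (2 ^ (j\<^sup>2))) = 0"
    by (intro sum.neutral) (auto simp: seminorm_term_def char_eq_1 le_imp_power_dvd power_mono)
  also have "(\<Sum>k. seminorm_term (k + j) (2 ^ (j\<^sup>2))) \<le> (\<Sum>k. 4 * pi * (1 / 2) ^ j * (1 / 2) ^ k)"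
    by (intro suminf_le * summable_ignore_initial_segment[OF seminorm_term_summable] summable_mult summable_geometric) auto
  also have "\<dots> = 8 * pi * (1 / 2) ^ j"
    by (subst suminf_mult) (auto simp: suminf_geometric)
  finally show ?thesis by simp
qed

lemma weight_power_tendsto: "(\<lambda>j. weight (2 ^ (j\<^sup>2))) \<longlonglongrightarrow> 0"
proof (rule tendsto_sandwich)
  show "(\<lambda>_. 0) \<longlonglongrightarrow> (0::real)" by simp
  show "(\<lambda>j. 8 * pi * (1 / 2) ^ j) \<longlonglongrightarrow> 0"
    using tendsto_mult[OF tendsto_const[of "8 * pi"] LIMSEQ_power_zero[of "1/2::real"]] by simp
qed (use weight_nonneg weight_power_le in auto)

text \<open>
  Half a period is as far from the kernel of the character as possible, so the growing factor
  \<open>2 ^ k\<close> makes the norm unbounded.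
\<close>

lemma weight_half_ge:
  assumes "k \<ge> 1" shows "weight (2 ^ (k\<^sup>2 - 1)) \<ge> 2 ^ k"
proof -
  have "seminorm_term k (2 ^ (k\<^sup>2 - 1)) = 2 ^ k * 2"
    using assms by (simp add: seminorm_term_def char_half del: One_nat_def)
  moreover have "seminorm_term k (2 ^ (k\<^sup>2 - 1)) \<le> weight (2 ^ (k\<^sup>2 - 1))"
    using sum_seminorm_term_le_weight[of "{k}" "2 ^ (k\<^sup>2 - 1)"] by simp
  moreover have "(0::real) < 2 ^ k"
    by simp
  ultimately show ?thesis by linarith
qed

text \<open>
  A lower bound for \<open>weight (m + n)\<close> from which \<open>weight n\<close> can be read off. Each term satisfies
  \<open>t (m + n) - t m \<ge> - t n\<close> and also \<open>t (m + n) - t m \<ge> t n - 2 * t m\<close>. The first estimate is used for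
  \<open>k < K\<close> and for \<open>k \<ge> L\<close>, the second one in between. Along a sequence of integers \<open>m\<close> with bounded
  norm, the middle sum over \<open>m\<close> is small in the limit once \<open>K\<close> is large, although the norms of the
  \<open>m\<close> themselves need not be; this is why the range is cut at \<open>K\<close> and \<open>L\<close>.
\<close>

lemma weight_recover:
  assumes "K \<le> L"
  shows "weight n \<le> weight (m + n) - weight m + 2 * (\<Sum>k<K. seminorm_term k n)
           + 2 * (\<Sum>k=K..<L. seminorm_term k m) + 2 * (weight n - (\<Sum>k<L. seminorm_term k n))"
proof -
  let ?t = seminorm_term
  have split: "weight p = (\<Sum>k. ?t (k + L) p) + (\<Sum>k=K..<L. ?t k p) + (\<Sum>k<K. ?t k p)" for p
  proof -
    have "(\<Sum>k<L. ?t k p) = (\<Sum>k<K. ?t k p) + (\<Sum>k=K..<L. ?t k p)"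
      using assms sum.atLeastLessThan_concat[of 0 K L "\<lambda>k. ?t k p"] by (simp add: atLeast0LessThan)
    then show ?thesis
      using suminf_split_initial_segment[OF seminorm_term_summable[of p], of L] by (simp add: weight_def)
  qed
  have lower: "?t k m - ?t k n \<le> ?t k (m + n)" "?t k n - ?t k m \<le> ?t k (m + n)" for k
    using seminorm_term_add_le[of k "m + n" "- n"] seminorm_term_add_le[of k "m + n" "- m"]
    by (simp_all add: seminorm_term_uminus)
  have s: "summable (\<lambda>k. ?t (k + L) p)" for p
    by (rule summable_ignore_initial_segment[OF seminorm_term_summable])
  have "(\<Sum>k. ?t (k + L) m) - (\<Sum>k. ?t (k + L) n) \<le> (\<Sum>k. ?t (k + L) (m + n))"
    by (subst suminf_diff[OF s s]) (intro suminf_le summable_diff s lower)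
  moreover have "(\<Sum>k=K..<L. ?t k n) - (\<Sum>k=K..<L. ?t k m) \<le> (\<Sum>k=K..<L. ?t k (m + n))"
    by (subst sum_subtractf[symmetric]) (intro sum_mono lower)
  moreover have "(\<Sum>k<K. ?t k m) - (\<Sum>k<K. ?t k n) \<le> (\<Sum>k<K. ?t k (m + n))"
    by (subst sum_subtractf[symmetric]) (intro sum_mono lower)
  moreover have "weight n - (\<Sum>k<L. ?t k n) = (\<Sum>k. ?t (k + L) n)"
    using suminf_split_initial_segment[OF seminorm_term_summable[of n], of L] by (simp add: weight_def)
  ultimately show ?thesis
    unfolding split[of n] split[of m] split[of "m + n"] by argo
qed

section \<open>A wave that drifts through all frequencies\<close>

definition char_prod :: "nat set \<Rightarrow> int \<Rightarrow> complex" where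
  "char_prod A n = (\<Prod>k\<in>A. char_circle k n)"

lemma char_prod_add: "char_prod A (m + n) = char_prod A m * char_prod A n"
  by (simp add: char_prod_def char_add prod.distrib)

lemma norm_char_prod [simp]: "cmod (char_prod A n) = 1"
  by (simp add: char_prod_def prod_norm[symmetric])

lemma norm_char_prod_minus_1_le:
  assumes "finite A" shows "cmod (char_prod A n - 1) \<le> weight n"
proof -
  have "cmod (char_prod A n - 1) \<le> (\<Sum>k\<in>A. cmod (char_circle k n - 1))"
    using norm_prod_diff[of A "\<lambda>k. char_circle k n" "\<lambda>_. 1"] by (simp add: char_prod_def)
  then show ?thesis
    using sum_norm_char_le_weight[OF assms, of n] by linarith
qed

definition log_weight :: "int \<Rightarrow> real" where
  "log_weight n = ln (1 + weight n)"

lemma log_weight_diff_le: "\<bar>log_weight m - log_weight n\<bar> \<le> \<bar>weight m - weight n\<bar>"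
proof -
  have "ln (1 + a) - ln (1 + b) \<le> \<bar>a - b\<bar>" if "a \<ge> 0" "b \<ge> 0" for a b :: real
  proof -
    have "ln (1 + a) - ln (1 + b) \<le> (a - b) / (1 + b)"
      using ln_diff_le[of "1 + a" "1 + b"] that by simp
    also have "\<dots> \<le> \<bar>a - b\<bar> / (1 + b)"
      using that by (intro divide_right_mono) auto
    also have "\<dots> \<le> \<bar>a - b\<bar> / 1"
      using that by (intro divide_left_mono) auto
    finally show ?thesis by simp
  qed
  from this[of "weight m" "weight n"] this[of "weight n" "weight m"] show ?thesis
    by (simp add: log_weight_def weight_nonneg abs_minus_commute abs_le_iff)
qed

lemma weight_shift_at_top:
  assumes "filterlim (\<lambda>i. weight (m i)) at_top F"
  shows "filterlim (\<lambda>i. weight (m i + a)) at_top F"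
proof -
  have "filterlim (\<lambda>i. - weight a + weight (m i)) at_top F"
    by (intro filterlim_tendsto_add_at_top[OF tendsto_const] assms)
  moreover have "- weight a + weight (m i) \<le> weight (m i + a)" for i
    using weight_diff_le[of "m i" a] by linarith
  ultimately show ?thesis
    by (auto intro: filterlim_at_top_mono always_eventually)
qed

text \<open>
  The point of taking the logarithm: far out in the norm, a fixed translation changes
  \<open>1 + weight\<close> only by a factor close to 1.
\<close>

lemma log_weight_slowly_varying:
  assumes "filterlim (\<lambda>i. weight (m i)) at_top F"
  shows "((\<lambda>i. log_weight (m i + a) - log_weight (m i)) \<longlongrightarrow> 0) F"
proof -
  have top: "filterlim (\<lambda>i. 1 + weight (m i)) at_top F"
    by (intro filterlim_tendsto_add_at_top[OF tendsto_const] assms)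
  have "((\<lambda>i. (weight (m i + a) - weight (m i)) / (1 + weight (m i))) \<longlongrightarrow> 0) F"
  proof (rule Lim_null_comparison)
    show "((\<lambda>i. weight a / (1 + weight (m i))) \<longlongrightarrow> 0) F"
      by (rule real_tendsto_divide_at_top[OF tendsto_const top])
    show "\<forall>\<^sub>F i in F. norm ((weight (m i + a) - weight (m i)) / (1 + weight (m i))) \<le> weight a / (1 + weight (m i))"
      using weight_nonneg weight_diff_le
      by (auto intro!: always_eventually divide_right_mono simp: abs_of_nonneg add_nonneg_nonneg)
  qed
  then have "((\<lambda>i. ln (1 + (weight (m i + a) - weight (m i)) / (1 + weight (m i)))) \<longlongrightarrow> ln (1 + 0)) F"
    by (intro tendsto_ln tendsto_add tendsto_const) auto
  moreover have "ln (1 + (weight (m i + a) - weight (m i)) / (1 + weight (m i))) = log_weight (m i + a) - log_weight (m i)" for i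
  proof -
    have "1 + weight (m i) > 0" "1 + weight (m i + a) > 0"
      using weight_nonneg[of "m i"] weight_nonneg[of "m i + a"] by auto
    then have "1 + (weight (m i + a) - weight (m i)) / (1 + weight (m i)) = (1 + weight (m i + a)) / (1 + weight (m i))"
      by (simp add: field_simps)
    then show ?thesis
      using \<open>1 + weight (m i) > 0\<close> \<open>1 + weight (m i + a) > 0\<close> by (simp add: log_weight_def ln_div)
  qed
  ultimately show ?thesis by simp
qed

definition amplitude :: "real \<Rightarrow> real" where
  "amplitude x = \<bar>sin (pi * x)\<bar>"

lemma amplitude_nonneg: "0 \<le> amplitude x" and amplitude_le_1: "amplitude x \<le> 1"
  by (simp_all add: amplitude_def)

lemma amplitude_lipschitz: "\<bar>amplitude x - amplitude y\<bar> \<le> pi * \<bar>x - y\<bar>"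
proof -
  have "\<bar>sin (pi * x) - sin (pi * y)\<bar> \<le> cmod (cis (pi * x) - cis (pi * y))"
    using abs_Im_le_cmod[of "cis (pi * x) - cis (pi * y)"] by simp
  also have "\<dots> \<le> \<bar>pi * x - pi * y\<bar>"
    by (rule norm_cis_diff_le)
  also have "\<dots> = pi * \<bar>x - y\<bar>"
    by (simp add: abs_mult flip: right_diff_distrib)
  finally show ?thesis
    unfolding amplitude_def using abs_triangle_ineq3 order_trans by blast
qed

lemma amplitude_of_int [simp]: "amplitude (of_int z) = 0"
  by (simp add: amplitude_def sin_zero_iff_int2)

lemma amplitude_half: "amplitude (of_int z + 1 / 2) = 1"
proof -
  have "sin (pi * (of_int z + 1 / 2)) = cos (pi * of_int z)"
    by (simp add: ring_distribs sin_add)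
  moreover have "\<bar>cos (pi * of_int z)\<bar> = 1"
    using sin_cos_squared_add[of "pi * of_int z"] sin_zero_iff_int2[of "pi * of_int z"]
    by (simp add: abs_square_eq_1 power2_eq_1_iff abs_if)
  ultimately show ?thesis by (simp add: amplitude_def)
qed

text \<open>
  If the floors differ, an integer lies between \<open>x\<close> and \<open>y\<close>, and the amplitude vanishes there.
\<close>

lemma amplitude_sum_le:
  assumes "\<lfloor>x\<rfloor> \<noteq> \<lfloor>y\<rfloor>" shows "amplitude x + amplitude y \<le> pi * \<bar>x - y\<bar>"
proof -
  have *: "amplitude x + amplitude y \<le> pi * \<bar>x - y\<bar>" if "\<lfloor>x\<rfloor> < \<lfloor>y\<rfloor>" for x y :: real
  proof -
    let ?z = "of_int \<lfloor>y\<rfloor> :: real"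
    have z: "x \<le> ?z" "?z \<le> y"
      using that by linarith+
    have "amplitude x \<le> pi * \<bar>x - ?z\<bar>" "amplitude y \<le> pi * \<bar>y - ?z\<bar>"
      using amplitude_lipschitz[of x ?z] amplitude_lipschitz[of y ?z] by simp_all
    then have "amplitude x + amplitude y \<le> pi * (\<bar>x - ?z\<bar> + \<bar>y - ?z\<bar>)"
      by (simp add: ring_distribs)
    also have "\<bar>x - ?z\<bar> + \<bar>y - ?z\<bar> = \<bar>x - y\<bar>"
      using z by linarith
    finally show ?thesis .
  qed
  show ?thesis
    using *[of x y] *[of y x] assms by (auto simp: abs_minus_commute add.commute neq_iff)
qed

text \<open>
  Projecting a code of pairs to the first component makes each finite set occur for infinitely
  many \<open>l\<close>, which lets a fixed frequency reappear arbitrarily far out.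
\<close>

definition frequency :: "int \<Rightarrow> nat set" where
  "frequency l = set_decode (fst (prod_decode (nat l)))"

lemma finite_frequency [simp]: "finite (frequency l)"
  by (simp add: frequency_def)

definition wave :: "int \<Rightarrow> complex" where
  "wave n = of_real (amplitude (log_weight n)) * char_prod (frequency \<lfloor>log_weight n\<rfloor>) n"

lemma norm_wave: "cmod (wave n) = amplitude (log_weight n)"
  by (simp add: wave_def norm_mult amplitude_nonneg)

lemma norm_wave_diff:
  assumes "\<lfloor>log_weight (m + n)\<rfloor> = l" "\<lfloor>log_weight m\<rfloor> = l"
  shows "cmod (wave (m + n) - wave m)
       = cmod (of_real (amplitude (log_weight (m + n))) * char_prod (frequency l) n - of_real (amplitude (log_weight m)))"
proof -
  have "wave (m + n) - wave m = char_prod (frequency l) m *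
      (of_real (amplitude (log_weight (m + n))) * char_prod (frequency l) n - of_real (amplitude (log_weight m)))"
    by (simp add: wave_def assms char_prod_add ring_distribs)
  then show ?thesis by (simp add: norm_mult)
qed

lemma amplitude_log_weight_diff_le: "\<bar>amplitude (log_weight (m + n)) - amplitude (log_weight m)\<bar> \<le> pi * weight n"
proof -
  have "\<bar>amplitude (log_weight (m + n)) - amplitude (log_weight m)\<bar> \<le> pi * \<bar>log_weight (m + n) - log_weight m\<bar>"
    by (rule amplitude_lipschitz)
  also have "\<dots> \<le> pi * weight n"
    using order_trans[OF log_weight_diff_le weight_diff_le] by (intro mult_left_mono) auto
  finally show ?thesis .
qed

text \<open>
  While the frequency is constant, both the amplitude and the character are Lipschitz. When the
  frequency changes, both values of the wave are small by \<open>amplitude_sum_le\<close>.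
\<close>

lemma wave_lipschitz: "cmod (wave (m + n) - wave m) \<le> 5 * weight n"
proof -
  have w: "0 \<le> weight n" and pi: "pi * weight n \<le> 4 * weight n"
    using pi_less_4 weight_nonneg[of n] by (auto intro: mult_right_mono)
  show ?thesis
  proof (cases "\<lfloor>log_weight (m + n)\<rfloor> = \<lfloor>log_weight m\<rfloor>")
    case True
    let ?D = "amplitude (log_weight m)" and ?D' = "amplitude (log_weight (m + n))"
    let ?c = "char_prod (frequency \<lfloor>log_weight m\<rfloor>) n"
    have "of_real ?D' * ?c - of_real ?D = of_real (?D' - ?D) * ?c + of_real ?D * (?c - 1)"
      by (simp add: ring_distribs)
    then have "cmod (wave (m + n) - wave m) = cmod (of_real (?D' - ?D) * ?c + of_real ?D * (?c - 1))"
      using norm_wave_diff[OF True refl] by simp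
    also have "\<dots> \<le> cmod (of_real (?D' - ?D) * ?c) + cmod (of_real ?D * (?c - 1))"
      by (rule norm_triangle_ineq)
    also have "\<dots> = \<bar>?D' - ?D\<bar> + ?D * cmod (?c - 1)"
      by (simp add: norm_mult amplitude_nonneg flip: of_real_diff)
    also have "\<dots> \<le> pi * weight n + 1 * weight n"
      by (intro add_mono mult_mono amplitude_log_weight_diff_le amplitude_le_1 norm_char_prod_minus_1_le)
         (auto simp: amplitude_nonneg)
    finally show ?thesis using pi by linarith
  next
    case False
    have "cmod (wave (m + n) - wave m) \<le> amplitude (log_weight (m + n)) + amplitude (log_weight m)"
      using norm_triangle_ineq4[of "wave (m + n)" "wave m"] by (simp add: norm_wave)
    also have "\<dots> \<le> pi * \<bar>log_weight (m + n) - log_weight m\<bar>"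
      by (rule amplitude_sum_le[OF False])
    also have "\<dots> \<le> pi * weight n"
      using order_trans[OF log_weight_diff_le weight_diff_le] by (intro mult_left_mono) auto
    finally show ?thesis using pi w by linarith
  qed
qed

text \<open>
  A wave with constant amplitude and frequency is a character up to a constant factor, so its
  increment over the step \<open>n\<close> has the same modulus everywhere. Where \<open>log_weight\<close> oscillates by at
  most \<open>\<eta>\<close> this remains true up to an error proportional to \<open>\<eta>\<close>: the amplitude varies by at most
  \<open>pi * \<eta>\<close>, and if the frequency changes nearby then the amplitude itself is of that order.
\<close>

lemma wave_isometry_defect:
  fixes a m n :: int
  defines "\<eta> \<equiv> \<bar>log_weight (m + a) - log_weight m\<bar> + \<bar>log_weight (m + n) - log_weight m\<bar> + \<bar>log_weight (m + a + n) - log_weight m\<bar>"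
  shows "\<bar>cmod (wave (m + a + n) - wave (m + a)) - cmod (wave (m + n) - wave m)\<bar> \<le> 8 * pi * \<eta>"
proof -
  let ?D = "\<lambda>p. amplitude (log_weight p)"
  have dev: "\<bar>?D (m + p) - ?D m\<bar> \<le> pi * \<bar>log_weight (m + p) - log_weight m\<bar>" for p
    by (rule amplitude_lipschitz)
  have \<eta>: "pi * \<eta> = pi * \<bar>log_weight (m + a) - log_weight m\<bar> + pi * \<bar>log_weight (m + n) - log_weight m\<bar> + pi * \<bar>log_weight (m + (a + n)) - log_weight m\<bar>"
    by (simp add: \<eta>_def ring_distribs add_ac)
  have nonneg: "0 \<le> pi * \<bar>log_weight (m + p) - log_weight m\<bar>" for p
    by simp
  show ?thesis
  proof (cases "\<forall>p\<in>{a, n, a + n}. \<lfloor>log_weight (m + p)\<rfloor> = \<lfloor>log_weight m\<rfloor>")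
    case True
    let ?c = "char_prod (frequency \<lfloor>log_weight m\<rfloor>) n"
    have fl: "\<lfloor>log_weight (m + a)\<rfloor> = \<lfloor>log_weight m\<rfloor>" "\<lfloor>log_weight (m + n)\<rfloor> = \<lfloor>log_weight m\<rfloor>"
       "\<lfloor>log_weight (m + a + n)\<rfloor> = \<lfloor>log_weight m\<rfloor>"
      using True by (auto simp: add.assoc)
    have "\<bar>cmod (wave (m + a + n) - wave (m + a)) - cmod (wave (m + n) - wave m)\<bar>
        \<le> cmod ((of_real (?D (m + a + n)) * ?c - of_real (?D (m + a))) - (of_real (?D (m + n)) * ?c - of_real (?D m)))"
      unfolding norm_wave_diff[OF fl(3) fl(1)] norm_wave_diff[OF fl(2) refl] by (rule norm_triangle_ineq3)
    also have "\<dots> = cmod (of_real (?D (m + a + n) - ?D (m + n)) * ?c - of_real (?D (m + a) - ?D m))"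
      by (rule arg_cong[where f = cmod]) (simp add: ring_distribs)
    also have "\<dots> \<le> cmod (of_real (?D (m + a + n) - ?D (m + n)) * ?c) + cmod (of_real (?D (m + a) - ?D m))"
      by (rule norm_triangle_ineq4)
    also have "\<dots> = \<bar>?D (m + a + n) - ?D (m + n)\<bar> + \<bar>?D (m + a) - ?D m\<bar>"
      by (simp only: norm_mult norm_char_prod norm_of_real mult_1_right)
    also have "\<dots> \<le> pi * \<eta>"
      using dev[of a] dev[of n] dev[of "a + n"] unfolding \<eta> add.assoc by linarith
    finally show ?thesis
      using nonneg[of a] nonneg[of n] nonneg[of "a + n"] \<eta> by linarith
  next
    case False
    then obtain p where p: "p \<in> {a, n, a + n}" "\<lfloor>log_weight (m + p)\<rfloor> \<noteq> \<lfloor>log_weight m\<rfloor>"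
      by blast
    have "?D m \<le> pi * \<bar>log_weight (m + p) - log_weight m\<bar>"
      using amplitude_sum_le[OF p(2)] amplitude_nonneg[of "log_weight (m + p)"] by linarith
    also have "\<dots> \<le> pi * \<eta>"
      using p(1) by (intro mult_left_mono) (auto simp: \<eta>_def add.assoc)
    finally have Dm: "?D m \<le> pi * \<eta>" .
    have "\<bar>cmod (wave (m + a + n) - wave (m + a)) - cmod (wave (m + n) - wave m)\<bar>
        \<le> ?D (m + (a + n)) + ?D (m + a) + (?D (m + n) + ?D m)"
      using norm_triangle_ineq4[of "wave (m + a + n)" "wave (m + a)"] norm_triangle_ineq4[of "wave (m + n)" "wave m"]
        norm_ge_zero[of "wave (m + a + n) - wave (m + a)"] norm_ge_zero[of "wave (m + n) - wave m"]
      unfolding norm_wave add.assoc by linarith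
    then show ?thesis
      using Dm dev[of a] dev[of n] dev[of "a + n"] \<eta> nonneg[of a] nonneg[of n] nonneg[of "a + n"] by linarith
  qed
qed

text \<open>
  The entries of the base point. The reciprocal in the first one compactifies the values of the
  norm, with 0 standing for an infinite norm.
\<close>

fun obs :: "nat \<Rightarrow> int \<Rightarrow> complex" where
  "obs 0 n = of_real (1 / (1 + weight n))"
| "obs (Suc 0) n = wave n"
| "obs (Suc (Suc k)) n = char_circle k n"

lemma obs_cases: obtains "k = 0" | "k = Suc 0" | j where "k = Suc (Suc j)"
  by (metis not0_implies_Suc)

lemma norm_obs_le: "cmod (obs k n) \<le> 1"
proof (cases k rule: obs_cases)
  case 1
  have "\<bar>1 / (1 + weight n)\<bar> \<le> 1"
    using weight_nonneg[of n] by simp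
  then show ?thesis
    by (simp only: 1 obs.simps norm_of_real)
qed (auto simp: norm_wave amplitude_le_1)

lemma obs_lipschitz: "cmod (obs k (m + n) - obs k m) \<le> 5 * weight n"
proof (cases k rule: obs_cases)
  case 1
  have pos: "weight (m + n) \<ge> 0" "weight m \<ge> 0" "weight n \<ge> 0"
    by (rule weight_nonneg)+
  have "\<bar>1 / (1 + x) - 1 / (1 + y)\<bar> \<le> \<bar>x - y\<bar>" if "x \<ge> 0" "y \<ge> 0" for x y :: real
  proof -
    have "1 / (1 + x) - 1 / (1 + y) = (y - x) / ((1 + x) * (1 + y))"
      using that by (simp add: field_simps)
    also have "\<bar>\<dots>\<bar> = \<bar>x - y\<bar> / ((1 + x) * (1 + y))"
      using that by (simp add: abs_mult)
    also have "\<dots> \<le> \<bar>x - y\<bar> / (1 * 1)"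
      using that by (intro divide_left_mono mult_mono) auto
    finally show ?thesis by simp
  qed
  then have "\<bar>1 / (1 + weight (m + n)) - 1 / (1 + weight m)\<bar> \<le> \<bar>weight (m + n) - weight m\<bar>"
    using pos by blast
  also have "\<dots> \<le> 5 * weight n"
    using weight_diff_le[of m n] pos by linarith
  finally show ?thesis
    by (simp only: 1 obs.simps norm_of_real flip: of_real_diff)
next
  case 2
  then show ?thesis by (simp add: wave_lipschitz)
next
  case (3 j)
  then show ?thesis
    using sum_norm_char_le_weight[of "{j}" n] weight_nonneg[of n] by (simp add: char_shift_diff)
qed

lemma obs_0_tendsto:
  assumes "filterlim (\<lambda>i. weight (m i)) at_top F"
  shows "((\<lambda>i. obs 0 (m i)) \<longlongrightarrow> 0) F"
proof -
  have "filterlim (\<lambda>i. 1 + weight (m i)) at_top F"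
    by (intro filterlim_tendsto_add_at_top[OF tendsto_const] assms)
  from tendsto_of_real[OF real_tendsto_divide_at_top[OF tendsto_const this, of 1]]
  show ?thesis by (simp only: obs.simps of_real_0)
qed

text \<open>
  For the characters the isometry is exact, the wave inherits it in the limit from
  \<open>wave_isometry_defect\<close>, and the first entry becomes constant.
\<close>

lemma obs_asymptotic_isometry:
  assumes lim: "filterlim (\<lambda>i. weight (m i)) at_top F"
  shows "((\<lambda>i. cmod (obs k (m i + a + n) - obs k (m i + a)) - cmod (obs k (m i + n) - obs k (m i))) \<longlongrightarrow> 0) F"
proof (cases k rule: obs_cases)
  case 1
  have "((\<lambda>i. obs 0 (m i + p)) \<longlongrightarrow> 0) F" for p
    by (rule obs_0_tendsto[OF weight_shift_at_top[OF lim]])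
  from this[of "a + n"] this[of a] this[of n] this[of 0]
  have "((\<lambda>i. cmod (obs 0 (m i + (a + n)) - obs 0 (m i + a)) - cmod (obs 0 (m i + n) - obs 0 (m i + 0)))
           \<longlongrightarrow> cmod (0 - 0) - cmod (0 - 0)) F"
    by (intro tendsto_intros)
  then show ?thesis by (simp add: 1 add.assoc)
next
  case 2
  have "((\<lambda>i. 8 * pi * (\<bar>log_weight (m i + a) - log_weight (m i)\<bar> + \<bar>log_weight (m i + n) - log_weight (m i)\<bar>
            + \<bar>log_weight (m i + (a + n)) - log_weight (m i)\<bar>)) \<longlongrightarrow> 8 * pi * (\<bar>0\<bar> + \<bar>0\<bar> + \<bar>0\<bar>)) F"
    by (intro tendsto_intros log_weight_slowly_varying lim)
  then have "((\<lambda>i. 8 * pi * (\<bar>log_weight (m i + a) - log_weight (m i)\<bar> + \<bar>log_weight (m i + n) - log_weight (m i)\<bar>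
            + \<bar>log_weight (m i + a + n) - log_weight (m i)\<bar>)) \<longlongrightarrow> 0) F"
    by (simp add: add.assoc)
  then have "((\<lambda>i. cmod (wave (m i + a + n) - wave (m i + a)) - cmod (wave (m i + n) - wave (m i))) \<longlongrightarrow> 0) F"
    by (rule Lim_null_comparison[rotated]) (use wave_isometry_defect in \<open>auto intro!: always_eventually\<close>)
  then show ?thesis by (simp add: 2)
next
  case (3 j)
  then show ?thesis by (simp add: char_shift_diff)
qed

text \<open>
  The norm of the multiples of \<open>2 ^ j\<^sup>2\<close> starts at 0, is unbounded, and increases by at most
  \<open>weight (2 ^ j\<^sup>2)\<close> per step; the first multiple whose norm reaches \<open>\<rho>\<close> overshoots by no more than that.
\<close>

lemma multiple_with_weight:
  assumes "\<rho> > 0"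
  obtains m where "2 ^ (j\<^sup>2) dvd m" "\<rho> \<le> weight m" "weight m \<le> \<rho> + weight (2 ^ (j\<^sup>2))"
proof -
  let ?q = "2 ^ (j\<^sup>2) :: int"
  define P where "P = (LEAST p. \<rho> \<le> weight (?q * int p))"
  have "\<exists>p. \<rho> \<le> weight (?q * int p)"
  proof -
    obtain k0 where k0: "\<rho> < 2 ^ k0"
      using real_arch_pow[of 2 \<rho>] by auto
    define k where "k = max k0 (Suc j)"
    have "j\<^sup>2 < k\<^sup>2"
      by (intro power_strict_mono) (auto simp: k_def)
    then have eq: "(2::int) ^ (k\<^sup>2 - 1) = ?q * int (2 ^ (k\<^sup>2 - 1 - j\<^sup>2))"
      by (simp flip: power_add)
    have "(2::real) ^ k0 \<le> 2 ^ k"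
      by (intro power_increasing) (auto simp: k_def)
    moreover have "2 ^ k \<le> weight (2 ^ (k\<^sup>2 - 1))"
      by (rule weight_half_ge) (simp add: k_def)
    ultimately have "\<rho> \<le> weight (2 ^ (k\<^sup>2 - 1))"
      using k0 by linarith
    then show ?thesis
      unfolding eq ..
  qed
  then have P: "\<rho> \<le> weight (?q * int P)"
    unfolding P_def by (rule LeastI_ex)
  moreover have "P \<noteq> 0"
    using P assms by (cases "P = 0") auto
  then obtain p where p: "P = Suc p"
    using not0_implies_Suc by blast
  have "weight (?q * int p) < \<rho>"
    using not_less_Least[of p "\<lambda>p. \<rho> \<le> weight (?q * int p)"] p unfolding P_def by simp
  then have "weight (?q * int P) \<le> \<rho> + weight ?q"
    using weight_add_le[of "?q * int p" ?q] by (simp add: p ring_distribs add.commute)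
  ultimately show ?thesis
    using that[of "?q * int P"] by simp
qed

text \<open>
  The translates are chosen divisible by \<open>2 ^ i\<^sup>2\<close>, so that every character is eventually
  unaffected, and with \<open>log_weight\<close> close to the midpoint between \<open>l\<close> and \<open>l + 1\<close>, where \<open>l\<close> is a
  large number with frequency \<open>A\<close>. At the midpoint the amplitude is 1 and the frequency is locally
  constant.
\<close>

lemma far_approximation:
  assumes A: "finite A"
  obtains m where "filterlim (\<lambda>i. weight (m i)) at_top sequentially"
    "\<And>k j. (\<lambda>i. obs (Suc (Suc k)) (j + m i)) \<longlonglongrightarrow> char_circle k j"
    "\<And>j. (\<lambda>i. obs (Suc 0) (j + m i)) \<longlonglongrightarrow> char_prod A j"
proof -
  \<comment> \<open>pairing with \<open>i\<close> makes \<open>l i\<close> tend to infinity without changing the frequency\<close>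
  define l where "l i = int (prod_encode (set_encode A, i))" for i
  have l_ge: "int i \<le> l i" for i
    by (simp add: l_def le_prod_encode_2)
  have freq: "frequency (l i) = A" for i
    using A by (simp add: frequency_def l_def)
  have "\<exists>m. 2 ^ (i\<^sup>2) dvd m \<and> exp (l i + 1 / 2) - 1 \<le> weight m \<and> weight m \<le> exp (l i + 1 / 2) - 1 + weight (2 ^ (i\<^sup>2))" for i
  proof -
    have "exp (real_of_int (l i) + 1 / 2) - 1 > 0"
      using l_ge[of i] by simp
    then show ?thesis
      by (rule multiple_with_weight[where j = i]) auto
  qed
  then obtain m where m: "\<And>i. 2 ^ (i\<^sup>2) dvd m i" "\<And>i. exp (l i + 1 / 2) - 1 \<le> weight (m i)"
      "\<And>i. weight (m i) \<le> exp (l i + 1 / 2) - 1 + weight (2 ^ (i\<^sup>2))"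
    by metis
  have char1: "char_circle k (m i) = 1" if "k \<le> i" for k i
  proof -
    have "(2::int) ^ (k\<^sup>2) dvd 2 ^ (i\<^sup>2)"
      using that by (intro le_imp_power_dvd power_mono) auto
    then show ?thesis
      using m(1)[of i] by (intro char_eq_1) (rule dvd_trans)
  qed
  show ?thesis
  proof
    show top: "filterlim (\<lambda>i. weight (m i)) at_top sequentially"
    proof (rule filterlim_at_top_mono[OF filterlim_real_sequentially], intro always_eventually allI)
      fix i
      have "real i \<le> real_of_int (l i) + 1 / 2"
        using l_ge[of i] by linarith
      also have "\<dots> \<le> exp (l i + 1 / 2) - 1"
        using exp_ge_add_one_self[of "l i + 1 / 2"] by linarith
      finally show "real i \<le> weight (m i)"
        using m(2)[of i] by linarith
    qed
    show "(\<lambda>i. obs (Suc (Suc k)) (j + m i)) \<longlonglongrightarrow> char_circle k j" for k j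
    proof (rule tendsto_eventually)
      show "\<forall>\<^sub>F i in sequentially. obs (Suc (Suc k)) (j + m i) = char_circle k j"
        using eventually_ge_at_top[of k] by eventually_elim (simp add: char_add char1)
    qed
    show "(\<lambda>i. obs (Suc 0) (j + m i)) \<longlonglongrightarrow> char_prod A j" for j
    proof -
      define e where "e i = log_weight (m i + j) - (l i + 1 / 2)" for i
      have near: "\<bar>log_weight (m i) - (l i + 1 / 2)\<bar> \<le> weight (2 ^ (i\<^sup>2))" for i
      proof -
        let ?E = "exp (real_of_int (l i) + 1 / 2)"
        have E: "1 \<le> ?E"
          using l_ge[of i] by simp
        have bounds: "?E \<le> 1 + weight (m i)" "1 + weight (m i) - ?E \<le> weight (2 ^ (i\<^sup>2))"
          using m(2,3)[of i] by linarith+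
        have "ln (1 + weight (m i)) - ln ?E \<le> (1 + weight (m i) - ?E) / ?E"
          using E bounds by (intro ln_diff_le) linarith+
        also have "\<dots> \<le> (1 + weight (m i) - ?E) / 1"
          using E bounds by (intro divide_left_mono) auto
        also have "\<dots> \<le> weight (2 ^ (i\<^sup>2))"
          using bounds by simp
        finally have "ln (1 + weight (m i)) - ln ?E \<le> weight (2 ^ (i\<^sup>2))" .
        moreover have "ln ?E \<le> ln (1 + weight (m i))"
          using E bounds by (intro ln_mono) linarith+
        ultimately have "\<bar>ln (1 + weight (m i)) - ln ?E\<bar> \<le> weight (2 ^ (i\<^sup>2))"
          by (simp only: abs_of_nonneg diff_ge_0_iff_ge)
        then show ?thesis
          by (simp add: log_weight_def)
      qed
      have "(\<lambda>i. log_weight (m i) - (l i + 1 / 2)) \<longlonglongrightarrow> 0"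
        by (rule Lim_null_comparison[OF _ weight_power_tendsto]) (use near in auto)
      from tendsto_add[OF log_weight_slowly_varying[OF top, of j] this]
      have e: "e \<longlonglongrightarrow> 0"
        by (simp add: e_def[abs_def] algebra_simps)
      have "(\<lambda>i. amplitude (log_weight (m i + j)) - 1) \<longlonglongrightarrow> 0"
      proof (rule Lim_null_comparison)
        show "\<forall>\<^sub>F i in sequentially. norm (amplitude (log_weight (m i + j)) - 1) \<le> pi * \<bar>e i\<bar>"
          using amplitude_lipschitz[of "log_weight (m i + j)" "l i + 1 / 2" for i]
          by (auto intro!: always_eventually simp: e_def amplitude_half)
        show "(\<lambda>i. pi * \<bar>e i\<bar>) \<longlonglongrightarrow> 0"
          using tendsto_mult[OF tendsto_const[of pi] tendsto_rabs[OF e]] by simp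
      qed
      then have "(\<lambda>i. amplitude (log_weight (m i + j))) \<longlonglongrightarrow> 1"
        by (simp add: LIM_zero_iff)
      then have lim: "(\<lambda>i. of_real (amplitude (log_weight (m i + j))) * char_prod A j) \<longlonglongrightarrow> of_real 1 * char_prod A j"
        by (intro tendsto_intros)
      have "\<forall>\<^sub>F i in sequentially. \<bar>e i\<bar> < 1 / 2"
        using tendstoD[OF e, of "1 / 2"] by (simp add: dist_real_def)
      moreover have "\<forall>\<^sub>F i in sequentially. \<forall>k\<in>A. char_circle k (m i) = 1"
        using A by (intro eventually_ball_finite ballI eventually_mono[OF eventually_ge_at_top] char1) auto
      ultimately have "\<forall>\<^sub>F i in sequentially.
          of_real (amplitude (log_weight (m i + j))) * char_prod A j = obs (Suc 0) (j + m i)"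
      proof eventually_elim
        case (elim i)
        then have "\<lfloor>log_weight (m i + j)\<rfloor> = l i"
          unfolding e_def by linarith
        moreover have "char_prod A (m i) = 1"
          using elim by (simp add: char_prod_def)
        ultimately show ?case
          by (simp add: wave_def freq char_prod_add add.commute[of j])
      qed
      from Lim_transform_eventually[OF lim this] show ?thesis by simp
    qed
  qed
qed

section \<open>Points as functions on the natural numbers\<close>

text \<open>
  A family of complex sequences indexed by \<open>\<int>\<close> is stored as one real sequence indexed by \<open>\<nat>\<close>: the
  triple names the sequence, the position, and whether the imaginary part is meant.
\<close>

definition slot :: "nat \<times> int \<times> bool \<Rightarrow> nat" where
  "slot = to_nat_on UNIV"

lemma bij_slot: "bij slot"
  unfolding slot_def by (intro to_nat_on_infinite) (auto simp: finite_prod infinite_UNIV_char_0)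

definition coord :: "(nat \<Rightarrow> real) \<Rightarrow> nat \<Rightarrow> int \<Rightarrow> complex" where
  "coord u k j = Complex (u (slot (k, j, False))) (u (slot (k, j, True)))"

definition from_coords :: "(nat \<Rightarrow> int \<Rightarrow> complex) \<Rightarrow> nat \<Rightarrow> real" where
  "from_coords f i = (case inv slot i of (k, j, b) \<Rightarrow> if b then Im (f k j) else Re (f k j))"

lemma from_coords_slot: "from_coords f (slot (k, j, b)) = (if b then Im (f k j) else Re (f k j))"
  using bij_slot by (simp add: from_coords_def inv_f_f bij_is_inj)

lemma coord_from_coords [simp]: "coord (from_coords f) = f"
  by (intro ext) (simp add: coord_def from_coords_slot)

lemma slot_exhaust: obtains k j b where "i = slot (k, j, b)"
  using bij_slot by (metis bij_pointE prod_cases3)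

lemma coord_inject: "coord u = coord v \<Longrightarrow> u = v"
proof
  fix i assume *: "coord u = coord v"
  obtain k j b where "i = slot (k, j, b)"
    by (rule slot_exhaust)
  then show "u i = v i"
    using fun_cong[OF fun_cong[OF *, of k], of j] by (cases b) (auto simp: coord_def)
qed

lemma entry_le_coord: "\<bar>u (slot (k, j, b)) - v (slot (k, j, b))\<bar> \<le> cmod (coord u k j - coord v k j)"
  using abs_Re_le_cmod[of "coord u k j - coord v k j"] abs_Im_le_cmod[of "coord u k j - coord v k j"]
  by (cases b) (auto simp: coord_def)

text \<open>
  This lemma and \<open>coords_close_if_dist_small\<close> say that the metric induces the product uniformity.
  All later estimates are made in coordinates and use the metric only through these two lemmas.
\<close>

lemma dist_lt_if_coords_close:
  assumes "\<epsilon> > 0"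
  obtains P \<delta> where "finite P" "\<delta> > 0"
    "\<And>u v. (\<And>k j. (k, j) \<in> P \<Longrightarrow> cmod (coord u k j - coord v k j) < \<delta>) \<Longrightarrow> dist u v < \<epsilon>"
proof -
  obtain N where N: "(1 / 2) ^ N < \<epsilon> / 2"
    using real_arch_pow_inv[of "\<epsilon> / 2" "1 / 2"] assms by auto
  define P where "P = (\<lambda>n. case inv slot (from_nat n) of (k, j, b) \<Rightarrow> (k, j)) ` {..N}"
  show ?thesis
  proof
    show "finite P" by (simp add: P_def)
    show "\<epsilon> / 4 > 0" using assms by simp
    fix u v :: "nat \<Rightarrow> real"
    assume close: "\<And>k j. (k, j) \<in> P \<Longrightarrow> cmod (coord u k j - coord v k j) < \<epsilon> / 4"
    have "dist (u (from_nat n)) (v (from_nat n)) \<le> \<epsilon> / 4" if "n \<le> N" for n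
    proof -
      obtain k j b where i: "from_nat n = slot (k, j, b)"
        by (rule slot_exhaust)
      then have "(k, j) \<in> P"
        using that bij_slot by (force simp: P_def inv_f_f bij_is_inj intro!: image_eqI[of _ _ n])
      then show ?thesis
        using close entry_le_coord[of u k j b v] by (fastforce simp: i dist_real_def)
    qed
    then have "Max {dist (u (from_nat n)) (v (from_nat n)) |n. n \<le> N} \<le> \<epsilon> / 4"
      by (intro Max.boundedI) auto
    then show "dist u v < \<epsilon>"
      using dist_fun_le_dist_first_terms[of u v N] N by linarith
  qed
qed

lemma entry_close_if_dist_small:
  fixes i :: nat
  assumes "e > 0"
  shows "\<exists>\<delta>>0. \<forall>u v :: nat \<Rightarrow> real. dist u v < \<delta> \<longrightarrow> \<bar>u i - v i\<bar> < e"
proof (intro exI conjI allI impI)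
  let ?n = "to_nat i"
  show "(1 / 2) ^ ?n * min e 1 > 0"
    using assms by simp
  fix u v :: "nat \<Rightarrow> real" assume d: "dist u v < (1 / 2) ^ ?n * min e 1"
  let ?f = "\<lambda>n. (1 / 2) ^ n * min (dist (u (from_nat n)) (v (from_nat n))) 1"
  have "summable ?f"
    by (rule summable_comparison_test'[of "\<lambda>n. (1 / 2) ^ n" 0]) (auto intro: summable_geometric)
  then have "sum ?f {?n} \<le> dist u v"
    unfolding dist_fun_def by (rule sum_le_suminf) auto
  then have "(1 / 2) ^ ?n * min \<bar>u i - v i\<bar> 1 \<le> dist u v"
    by (simp add: dist_real_def)
  from le_less_trans[OF this d] have "(1 / 2) ^ ?n * min \<bar>u i - v i\<bar> 1 < (1 / 2) ^ ?n * min e 1" .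
  then have "min \<bar>u i - v i\<bar> 1 < min e 1"
    by (simp only: mult_less_cancel_left_pos zero_less_power zero_less_divide_1_iff zero_less_numeral)
  then show "\<bar>u i - v i\<bar> < e" by linarith
qed

lemma coords_close_if_dist_small:
  assumes "finite P" "e > 0"
  obtains \<delta> where "\<delta> > 0"
    "\<And>u v k j. dist u v < \<delta> \<Longrightarrow> (k, j) \<in> P \<Longrightarrow> cmod (coord u k j - coord v k j) < e"
proof -
  let ?Q = "\<lambda>k j \<delta>. \<forall>u v. dist u v < \<delta> \<longrightarrow> cmod (coord u k j - coord v k j) < e"
  have "\<forall>\<^sub>F \<delta> in at_right 0. ?Q k j \<delta>" for k j
  proof -
    obtain \<delta>1 where \<delta>1: "\<delta>1 > 0" "\<And>u v :: nat \<Rightarrow> real. dist u v < \<delta>1 \<Longrightarrow> \<bar>u (slot (k, j, False)) - v (slot (k, j, False))\<bar> < e / 2"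
      using entry_close_if_dist_small[of "e / 2" "slot (k, j, False)"] assms(2) by auto
    obtain \<delta>2 where \<delta>2: "\<delta>2 > 0" "\<And>u v :: nat \<Rightarrow> real. dist u v < \<delta>2 \<Longrightarrow> \<bar>u (slot (k, j, True)) - v (slot (k, j, True))\<bar> < e / 2"
      using entry_close_if_dist_small[of "e / 2" "slot (k, j, True)"] assms(2) by auto
    have "?Q k j \<delta>" if "\<delta> < min \<delta>1 \<delta>2" for \<delta>
    proof (intro allI impI)
      fix u v :: "nat \<Rightarrow> real" assume "dist u v < \<delta>"
      then have "\<bar>Re (coord u k j - coord v k j)\<bar> < e / 2" "\<bar>Im (coord u k j - coord v k j)\<bar> < e / 2"
        using \<delta>1(2)[of u v] \<delta>2(2)[of u v] that by (auto simp: coord_def)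
      then show "cmod (coord u k j - coord v k j) < e"
        using cmod_le[of "coord u k j - coord v k j"] by linarith
    qed
    then show ?thesis
      using \<delta>1(1) \<delta>2(1) unfolding eventually_at_right_field by (metis min_less_iff_conj)
  qed
  then have "\<forall>\<^sub>F \<delta> in at_right 0. \<forall>(k, j)\<in>P. ?Q k j \<delta>"
    using assms(1) by (intro eventually_ball_finite) auto
  then have "\<forall>\<^sub>F \<delta> in at_right (0::real). (\<forall>(k, j)\<in>P. ?Q k j \<delta>) \<and> \<delta> > 0"
    using eventually_at_right_less by (rule eventually_conj)
  then obtain \<delta> where "\<delta> > 0" "\<forall>(k, j)\<in>P. ?Q k j \<delta>"
    using eventually_happens' trivial_limit_at_right_real by blast
  then show ?thesis
    using that[of \<delta>] by blast
qed

lemma tendsto_iff_coords: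
  "(f \<longlongrightarrow> u) F \<longleftrightarrow> (\<forall>k j. ((\<lambda>i. coord (f i) k j) \<longlongrightarrow> coord u k j) F)"
proof (intro iffI allI)
  fix k j assume lim: "(f \<longlongrightarrow> u) F"
  have "((\<lambda>i. f i p) \<longlongrightarrow> u p) F" for p
    by (rule continuous_on_tendsto_compose[OF continuous_on_product_coordinates lim]) auto
  then show "((\<lambda>i. coord (f i) k j) \<longlongrightarrow> coord u k j) F"
    unfolding coord_def by (intro tendsto_Complex)
next
  assume lim: "\<forall>k j. ((\<lambda>i. coord (f i) k j) \<longlongrightarrow> coord u k j) F"
  show "(f \<longlongrightarrow> u) F"
  proof (rule tendstoI)
    fix e :: real assume "e > 0"
    then obtain P \<delta> where P: "finite P" "\<delta> > 0"
        "\<And>u v. (\<And>k j. (k, j) \<in> P \<Longrightarrow> cmod (coord u k j - coord v k j) < \<delta>) \<Longrightarrow> dist u v < e"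
      using dist_lt_if_coords_close by blast
    have "\<forall>\<^sub>F i in F. \<forall>p\<in>P. cmod (coord (f i) (fst p) (snd p) - coord u (fst p) (snd p)) < \<delta>"
      using P(1) tendstoD[OF lim[rule_format] P(2)]
      by (intro eventually_ball_finite) (auto simp: dist_norm)
    then show "\<forall>\<^sub>F i in F. dist (f i) u < e"
      by eventually_elim (rule P(3), force)
  qed
qed

definition shift :: "int \<Rightarrow> (nat \<Rightarrow> real) \<Rightarrow> nat \<Rightarrow> real" where
  "shift n u = from_coords (\<lambda>k j. coord u k (j + n))"

lemma coord_shift [simp]: "coord (shift n u) k j = coord u k (j + n)"
  by (simp add: shift_def)

interpretation shift: integer_flow shift
proof
  show "shift 0 x = x" for x
    by (rule coord_inject) (simp add: fun_eq_iff)
  show "shift (m + n) x = shift m (shift n x)" for m n x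
    by (rule coord_inject) (simp add: fun_eq_iff add_ac)
  show "continuous_on UNIV (shift n)" for n
    unfolding continuous_on_def tendsto_iff_coords coord_shift
    using tendsto_iff_coords[THEN iffD1, OF tendsto_ident_at] by blast
qed

section \<open>The orbit closure of the base point\<close>

definition base_point :: "nat \<Rightarrow> real" where
  "base_point = from_coords obs"

lemma coord_base_point [simp]: "coord base_point = obs"
  by (simp add: base_point_def)

definition orbit_space :: "(nat \<Rightarrow> real) set" where
  "orbit_space = closure (shift.traj base_point)"

lemma orbit_space_sequence:
  assumes "u \<in> orbit_space"
  obtains m where "\<And>k j. (\<lambda>i. obs k (j + m i)) \<longlonglongrightarrow> coord u k j"
proof -
  obtain f where f: "\<And>i. f i \<in> shift.traj base_point" "f \<longlonglongrightarrow> u"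
    using assms by (auto simp: orbit_space_def closure_sequential)
  have "\<forall>i. \<exists>n. f i = shift n base_point"
    using f(1) by (auto simp: shift.traj_def image_iff)
  then obtain m where "\<And>i. f i = shift (m i) base_point"
    by metis
  then show ?thesis
    using f(2) that[of m] by (simp add: tendsto_iff_coords)
qed

lemma orbit_spaceI:
  assumes "\<And>k j. (\<lambda>i. obs k (j + m i)) \<longlonglongrightarrow> coord u k j"
  shows "u \<in> orbit_space"
  unfolding orbit_space_def closure_sequential
proof (intro exI conjI allI)
  show "(\<lambda>i. shift (m i) base_point) \<longlonglongrightarrow> u"
    unfolding tendsto_iff_coords using assms by simp
qed (auto simp: shift.traj_def)

lemma compact_orbit_space: "compact orbit_space"
proof -
  let ?K = "PiE UNIV (\<lambda>_. {-1..1}) :: (nat \<Rightarrow> real) set"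
  have "compactin (product_topology (\<lambda>_. euclidean) UNIV) ?K"
    by (subst compactin_PiE) auto
  then have K: "compact ?K"
    by (simp add: euclidean_product_topology)
  have "shift.traj base_point \<subseteq> ?K"
  proof
    fix u assume "u \<in> shift.traj base_point"
    then obtain n where u: "u = shift n base_point"
      by (auto simp: shift.traj_def)
    have "\<bar>u i\<bar> \<le> 1" for i
    proof -
      obtain k j b where i: "i = slot (k, j, b)"
        by (rule slot_exhaust)
      show ?thesis
        using abs_Re_le_cmod[of "obs k (j + n)"] abs_Im_le_cmod[of "obs k (j + n)"] norm_obs_le[of k "j + n"]
        by (simp add: u i shift_def from_coords_slot)
    qed
    then have "u i \<in> {-1..1}" for i
      by (simp add: abs_le_iff minus_le_iff)
    then show "u \<in> ?K"
      by (auto simp: PiE_def)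
  qed
  then have "orbit_space \<subseteq> ?K"
    unfolding orbit_space_def using K by (intro closure_minimal compact_imp_closed)
  then show ?thesis
    using compact_Int_closed[OF K, of orbit_space] by (simp add: orbit_space_def inf.absorb2)
qed

interpretation shift: compact_integer_flow shift orbit_space
proof
  show "compact orbit_space" by (rule compact_orbit_space)
  show "shift n u \<in> orbit_space" if "u \<in> orbit_space" for n u
    using that shift.flow_closure shift.traj_invariant by (metis orbit_space_def)
qed

lemma weight_at_top_if_obs_0_tendsto_0:
  assumes "((\<lambda>i. obs 0 (m i)) \<longlongrightarrow> 0) F"
  shows "filterlim (\<lambda>i. weight (m i)) at_top F"
proof -
  have "((\<lambda>i. 1 / (1 + weight (m i))) \<longlongrightarrow> 0) F"
    using tendsto_Re[OF assms] by (simp del: of_real_divide)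
  then have "filterlim (\<lambda>i. inverse (1 / (1 + weight (m i)))) at_top F"
    using weight_nonneg by (intro filterlim_inverse_at_top) (auto intro!: always_eventually add_pos_nonneg)
  then have "filterlim (\<lambda>i. 1 + weight (m i)) at_top F"
    by simp
  from filterlim_tendsto_add_at_top[OF tendsto_const[of "-1"] this] show ?thesis
    by simp
qed

lemma far_point_isometry:
  assumes u: "u \<in> orbit_space" and far: "coord u 0 0 = 0"
  shows "cmod (coord u k (a + n) - coord u k a) = cmod (coord u k n - coord u k 0)"
proof -
  obtain m where m: "\<And>k j. (\<lambda>i. obs k (j + m i)) \<longlonglongrightarrow> coord u k j"
    using orbit_space_sequence[OF u] by blast
  have "filterlim (\<lambda>i. weight (m i)) at_top sequentially"
    using m[of 0 0] far by (intro weight_at_top_if_obs_0_tendsto_0) simp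
  from obs_asymptotic_isometry[OF this, of k a n]
  have "(\<lambda>i. cmod (obs k (a + n + m i) - obs k (a + m i)) - cmod (obs k (n + m i) - obs k (0 + m i))) \<longlonglongrightarrow> 0"
    by (simp add: add_ac)
  moreover have "(\<lambda>i. cmod (obs k (a + n + m i) - obs k (a + m i)) - cmod (obs k (n + m i) - obs k (0 + m i)))
      \<longlonglongrightarrow> cmod (coord u k (a + n) - coord u k a) - cmod (coord u k n - coord u k 0)"
    by (intro tendsto_intros m)
  ultimately show ?thesis
    using LIMSEQ_unique by fastforce
qed

text \<open>
  Let the point be the limit of translates by \<open>m i\<close> with bounded norm. By Fatou the limits \<open>\<tau> k\<close> of the
  norm terms of \<open>m i\<close> are summable, so their tail from some \<open>K\<close> on is below \<open>\<epsilon>\<close>. If \<open>n\<close> returns the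
  point close to itself, the entry \<open>1 / (1 + weight)\<close> shows that \<open>weight (m i + n) - weight (m i)\<close> is small in
  the limit, and the characters below \<open>K\<close> show that the first \<open>K\<close> norm terms of \<open>n\<close> are small.
  Then \<open>weight_recover\<close> bounds the norm of \<open>n\<close> itself. The norms of the \<open>m i\<close> may be strictly larger
  in the limit than the sum of the \<open>\<tau> k\<close>, but the escaping part cancels in the difference.
\<close>

lemma near_point_return_weight:
  assumes u: "u \<in> orbit_space" and near: "coord u 0 0 \<noteq> 0" and \<epsilon>: "\<epsilon> > 0"
  shows "\<exists>\<delta>>0. \<forall>n. dist (shift n u) u < \<delta> \<longrightarrow> weight n \<le> 5 * \<epsilon>"
proof -
  obtain m where m: "\<And>k j. (\<lambda>i. obs k (j + m i)) \<longlonglongrightarrow> coord u k j"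
    using orbit_space_sequence[OF u] by blast
  define c where "c j = Re (coord u 0 j)" for j
  have c_lim: "(\<lambda>i. 1 / (1 + weight (j + m i))) \<longlonglongrightarrow> c j" for j
    using tendsto_Re[OF m[of 0 j]] by (simp add: c_def del: of_real_divide)
  have "(\<lambda>i. Im (obs 0 (0 + m i))) \<longlonglongrightarrow> Im (coord u 0 0)"
    by (rule tendsto_Im[OF m])
  then have "Im (coord u 0 0) = 0"
    by (simp add: LIMSEQ_const_iff del: of_real_divide)
  then have "c 0 \<noteq> 0"
    using near by (auto simp: c_def complex_eq_iff)
  moreover have "c 0 \<ge> 0"
    by (rule tendsto_lowerbound[OF c_lim]) (use weight_nonneg in auto)
  ultimately have c0: "c 0 > 0" by simp
  have weight_lim: "(\<lambda>i. weight (j + m i)) \<longlonglongrightarrow> 1 / c j - 1" if "c j \<noteq> 0" for j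
    using tendsto_diff[OF tendsto_divide[OF tendsto_const[of 1] c_lim that] tendsto_const[of 1]] by simp

  define \<tau> where "\<tau> k = 2 ^ k * cmod (coord u (Suc (Suc k)) 0 - 1)" for k
  have term_lim: "(\<lambda>i. seminorm_term k (m i)) \<longlonglongrightarrow> \<tau> k" for k
    using m[of "Suc (Suc k)" 0] unfolding \<tau>_def seminorm_term_def
    by (intro tendsto_intros) simp
  have "summable \<tau>"
  proof (rule summableI_nonneg_bounded)
    show "0 \<le> \<tau> k" for k by (simp add: \<tau>_def)
    show "(\<Sum>k<L. \<tau> k) \<le> 1 / c 0 - 1" for L
    proof (rule LIMSEQ_le)
      show "(\<lambda>i. \<Sum>k<L. seminorm_term k (m i)) \<longlonglongrightarrow> (\<Sum>k<L. \<tau> k)"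
        by (intro tendsto_sum term_lim)
      show "(\<lambda>i. weight (m i)) \<longlonglongrightarrow> 1 / c 0 - 1"
        using weight_lim[of 0] c0 by simp
    qed (auto intro: sum_seminorm_term_le_weight)
  qed
  then obtain K where K: "\<And>L. (\<Sum>k=K..<L. \<tau> k) < \<epsilon>"
    using \<epsilon> by (force simp: summable_Cauchy dest: abs_ge_self[THEN le_less_trans])

  have "((\<lambda>x. 1 / x) \<longlongrightarrow> 1 / c 0) (at (c 0))"
    using c0 by (intro tendsto_intros) auto
  then obtain r where r: "r > 0" "\<And>x. x \<noteq> c 0 \<Longrightarrow> \<bar>x - c 0\<bar> < r \<Longrightarrow> \<bar>1 / x - 1 / c 0\<bar> < \<epsilon>"
    using \<epsilon> by (auto simp: LIM_eq)
  \<comment> \<open>\<open>c 0\<close> keeps the first entry positive; the last bound makes \<open>K\<close> norm terms, each with a factor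
    of at most \<open>2 ^ K\<close>, add up to at most \<open>\<epsilon>\<close>\<close>
  define e where "e = Min {r, c 0, \<epsilon> / (2 ^ K * (real K + 1))}"
  have e: "e > 0" "e \<le> r" "e \<le> c 0" "e \<le> \<epsilon> / (2 ^ K * (real K + 1))"
    using r(1) c0 \<epsilon> by (auto simp: e_def)
  obtain \<delta> where \<delta>: "\<delta> > 0" "\<And>v w k j. dist v w < \<delta> \<Longrightarrow> (k, j) \<in> {..K + 1} \<times> {0} \<Longrightarrow> cmod (coord v k j - coord w k j) < e"
    using coords_close_if_dist_small[of "{..K + 1} \<times> {0}" e] e(1) by auto
  have "weight n \<le> 5 * \<epsilon>" if ret: "dist (shift n u) u < \<delta>" for n
  proof -
    have close: "cmod (coord u k n - coord u k 0) < e" if "k \<le> K + 1" for k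
      using \<delta>(2)[OF ret, of k 0] that by simp
    have "\<bar>c n - c 0\<bar> < e"
      using close[of 0] abs_Re_le_cmod[of "coord u 0 n - coord u 0 0"] by (simp add: c_def)
    then have cn: "c n > 0" "\<bar>1 / c n - 1 / c 0\<bar> < \<epsilon>"
      using e r(2)[of "c n"] \<epsilon> by (cases "c n = c 0"; force)+
    have term_le: "seminorm_term k n \<le> \<epsilon> / (real K + 1)" if "k < K" for k
    proof -
      have "(\<lambda>i. cmod (obs (Suc (Suc k)) (n + m i) - obs (Suc (Suc k)) (0 + m i)))
          \<longlonglongrightarrow> cmod (coord u (Suc (Suc k)) n - coord u (Suc (Suc k)) 0)"
        by (intro tendsto_intros m)
      then have "cmod (char_circle k n - 1) = cmod (coord u (Suc (Suc k)) n - coord u (Suc (Suc k)) 0)"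
        using char_shift_diff[of k _ n] by (simp add: add.commute[of n] LIMSEQ_const_iff)
      then have "cmod (char_circle k n - 1) \<le> \<epsilon> / (2 ^ K * (real K + 1))"
        using close[of "Suc (Suc k)"] e(4) that by simp
      then have "seminorm_term k n \<le> 2 ^ K * (\<epsilon> / (2 ^ K * (real K + 1)))"
        unfolding seminorm_term_def using that by (intro mult_mono) (auto intro: power_increasing)
      then show ?thesis by simp
    qed
    have "(\<Sum>k<K. seminorm_term k n) \<le> real K * (\<epsilon> / (real K + 1))"
      using sum_bounded_above[of "{..<K}" "\<lambda>k. seminorm_term k n" "\<epsilon> / (real K + 1)"] term_le
      by simp
    also have "\<dots> \<le> \<epsilon>"
      using \<epsilon> by (simp add: field_simps)
    finally have head: "(\<Sum>k<K. seminorm_term k n) \<le> \<epsilon>" .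
    have "weight n \<le> 5 * \<epsilon> + 2 * (weight n - (\<Sum>k<L. seminorm_term k n))" if "L \<ge> K" for L
    proof -
      have "weight n \<le> (1 / c n - 1) - (1 / c 0 - 1) + 2 * (\<Sum>k<K. seminorm_term k n)
           + 2 * (\<Sum>k=K..<L. \<tau> k) + 2 * (weight n - (\<Sum>k<L. seminorm_term k n))"
      proof (rule LIMSEQ_le_const)
        have "(\<lambda>i. weight (n + m i) - weight (0 + m i) + 2 * (\<Sum>k<K. seminorm_term k n)
           + 2 * (\<Sum>k=K..<L. seminorm_term k (m i)) + 2 * (weight n - (\<Sum>k<L. seminorm_term k n)))
           \<longlonglongrightarrow> (1 / c n - 1) - (1 / c 0 - 1) + 2 * (\<Sum>k<K. seminorm_term k n)
           + 2 * (\<Sum>k=K..<L. \<tau> k) + 2 * (weight n - (\<Sum>k<L. seminorm_term k n))"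
          using cn(1) c0 by (intro tendsto_intros weight_lim term_lim) auto
        then show "(\<lambda>i. weight (m i + n) - weight (m i) + 2 * (\<Sum>k<K. seminorm_term k n)
           + 2 * (\<Sum>k=K..<L. seminorm_term k (m i)) + 2 * (weight n - (\<Sum>k<L. seminorm_term k n)))
           \<longlonglongrightarrow> (1 / c n - 1) - (1 / c 0 - 1) + 2 * (\<Sum>k<K. seminorm_term k n)
           + 2 * (\<Sum>k=K..<L. \<tau> k) + 2 * (weight n - (\<Sum>k<L. seminorm_term k n))"
          by (simp add: add.commute[of n])
        show "\<exists>N. \<forall>i\<ge>N. weight n \<le> weight (m i + n) - weight (m i) + 2 * (\<Sum>k<K. seminorm_term k n)
           + 2 * (\<Sum>k=K..<L. seminorm_term k (m i)) + 2 * (weight n - (\<Sum>k<L. seminorm_term k n))"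
          using weight_recover[OF that] by blast
      qed
      then show ?thesis
        using head K[of L] cn(2) by linarith
    qed
    then have ev: "\<exists>N. \<forall>L\<ge>N. weight n \<le> 5 * \<epsilon> + 2 * (weight n - (\<Sum>k<L. seminorm_term k n))"
      by blast
    have "(\<lambda>L. 5 * \<epsilon> + 2 * (weight n - (\<Sum>k<L. seminorm_term k n))) \<longlonglongrightarrow> 5 * \<epsilon> + 2 * (weight n - weight n)"
      unfolding weight_def by (intro tendsto_intros summable_LIMSEQ seminorm_term_summable)
    from LIMSEQ_le_const[OF this ev] show "weight n \<le> 5 * \<epsilon>"
      by simp
  qed
  then show ?thesis
    using \<delta>(1) by blast
qed

text \<open>
  At a point at infinity the coordinates that decide closeness at time \<open>a\<close> move exactly as they do
  at time 0. At the other points a return has small norm and is therefore uniform by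
  \<open>obs_lipschitz\<close>.
\<close>

lemma orbit_space_locally_equicontinuous: "shift.locally_equicontinuous"
  unfolding shift.locally_equicontinuous_def
proof (intro ballI shift.equicontinuity_point_orbit_closureI)
  fix u and \<epsilon> :: real assume u: "u \<in> orbit_space" and "\<epsilon> > 0"
  then obtain P e where P: "finite P" "e > 0"
      "\<And>v w. (\<And>k j. (k, j) \<in> P \<Longrightarrow> cmod (coord v k j - coord w k j) < e) \<Longrightarrow> dist v w < \<epsilon>"
    using dist_lt_if_coords_close by metis
  show "\<exists>\<delta>>0. \<forall>n. dist (shift n u) u < \<delta> \<longrightarrow> (\<forall>a. dist (shift (a + n) u) (shift a u) \<le> \<epsilon>)"
  proof (cases "coord u 0 0 = 0")
    case True
    obtain \<delta> where \<delta>: "\<delta> > 0" "\<And>v w k j. dist v w < \<delta> \<Longrightarrow> (k, j) \<in> P \<Longrightarrow> cmod (coord v k j - coord w k j) < e"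
      using coords_close_if_dist_small P by metis
    have "dist (shift (a + n) u) (shift a u) < \<epsilon>" if "dist (shift n u) u < \<delta>" for n a
    proof (rule P(3))
      fix k j assume "(k, j) \<in> P"
      then have "cmod (coord u k (j + n) - coord u k j) < e"
        using \<delta>(2)[OF that] by simp
      then show "cmod (coord (shift (a + n) u) k j - coord (shift a u) k j) < e"
        using far_point_isometry[OF u True, of k j n] far_point_isometry[OF u True, of k "j + a" n]
        by (simp add: add.assoc)
    qed
    then show ?thesis
      using \<delta>(1) by (meson less_imp_le)
  next
    case False
    obtain m where m: "\<And>k j. (\<lambda>i. obs k (j + m i)) \<longlonglongrightarrow> coord u k j"
      using orbit_space_sequence[OF u] by blast
    \<comment> \<open>26 exceeds the product of the Lipschitz constant 5 and the factor 5 in the return estimate\<close>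
    obtain \<delta> where \<delta>: "\<delta> > 0" "\<And>n. dist (shift n u) u < \<delta> \<Longrightarrow> weight n \<le> 5 * (e / 26)"
      using near_point_return_weight[OF u False, of "e / 26"] P(2) by auto
    have "dist (shift (a + n) u) (shift a u) < \<epsilon>" if "dist (shift n u) u < \<delta>" for n a
    proof (rule P(3))
      fix k j
      have "cmod (coord u k (j + a + n) - coord u k (j + a)) \<le> 5 * weight n"
      proof (rule LIMSEQ_le_const2)
        show "(\<lambda>i. cmod (obs k (j + a + n + m i) - obs k (j + a + m i))) \<longlonglongrightarrow> cmod (coord u k (j + a + n) - coord u k (j + a))"
          by (intro tendsto_intros m)
        show "\<exists>N. \<forall>i\<ge>N. cmod (obs k (j + a + n + m i) - obs k (j + a + m i)) \<le> 5 * weight n"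
          using obs_lipschitz[of k "j + a + m i" n for i] by (simp add: add_ac)
      qed
      then show "cmod (coord (shift (a + n) u) k j - coord (shift a u) k j) < e"
        using \<delta>(2)[OF that] P(2) by (simp add: add.assoc)
    qed
    then show ?thesis
      using \<delta>(1) by (meson less_imp_le)
  qed
qed

lemma orbit_space_recurrent_transitive: "shift.recurrent_transitive"
proof (rule shift.recurrent_transitiveI)
  show "orbit_space = closure (shift.traj base_point)"
    by (rule orbit_space_def)
  have "int i \<le> 2 ^ (i\<^sup>2)" for i
  proof -
    have "i \<le> i\<^sup>2"
      by (simp add: power2_nat_le_imp_le power2_eq_square)
    also have "\<dots> < 2 ^ (i\<^sup>2)"
      by (rule less_exp)
    finally show ?thesis
      by (metis less_imp_le of_nat_le_iff of_nat_numeral of_nat_power)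
  qed
  then show "filterlim (\<lambda>i. 2 ^ (i\<^sup>2) :: int) at_top sequentially"
    by (intro filterlim_at_top_mono[OF filterlim_int_sequentially] always_eventually allI)
  show "(\<lambda>i. shift (2 ^ (i\<^sup>2)) base_point) \<longlonglongrightarrow> base_point"
    unfolding tendsto_iff_coords coord_shift coord_base_point
  proof (intro allI)
    fix k j
    have "(\<lambda>i. obs k (j + 2 ^ (i\<^sup>2)) - obs k j) \<longlonglongrightarrow> 0"
    proof (rule Lim_null_comparison)
      show "\<forall>\<^sub>F i in sequentially. cmod (obs k (j + 2 ^ (i\<^sup>2)) - obs k j) \<le> 5 * weight (2 ^ (i\<^sup>2))"
        by (intro always_eventually allI obs_lipschitz)
      show "(\<lambda>i. 5 * weight (2 ^ (i\<^sup>2))) \<longlonglongrightarrow> 0"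
        using tendsto_mult[OF tendsto_const[of 5] weight_power_tendsto] by simp
    qed
    then show "(\<lambda>i. obs k (j + 2 ^ (i\<^sup>2))) \<longlonglongrightarrow> obs k j"
      by (simp add: LIM_zero_iff)
  qed
qed

fun far_obs :: "nat set \<Rightarrow> nat \<Rightarrow> int \<Rightarrow> complex" where
  "far_obs A 0 n = 0"
| "far_obs A (Suc 0) n = char_prod A n"
| "far_obs A (Suc (Suc k)) n = char_circle k n"

lemma far_point_in_orbit_space:
  assumes "finite A" shows "from_coords (far_obs A) \<in> orbit_space"
proof -
  obtain m where m: "filterlim (\<lambda>i. weight (m i)) at_top sequentially"
    "\<And>k j. (\<lambda>i. obs (Suc (Suc k)) (j + m i)) \<longlonglongrightarrow> char_circle k j"
    "\<And>j. (\<lambda>i. obs (Suc 0) (j + m i)) \<longlonglongrightarrow> char_prod A j"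
    using far_approximation[OF assms] by blast
  have "(\<lambda>i. obs k (j + m i)) \<longlonglongrightarrow> coord (from_coords (far_obs A)) k j" for k j
  proof (cases k rule: obs_cases)
    case 1
    then show ?thesis
      using obs_0_tendsto[OF weight_shift_at_top[OF m(1), of j]] by (simp add: add.commute[of j] del: obs.simps)
  qed (use m in \<open>simp_all del: obs.simps\<close>)
  then show ?thesis by (rule orbit_spaceI)
qed

text \<open>
  The orbits of the points \<open>from_coords (far_obs A)\<close> form an invariant set on which the flow is
  sensitive: enlarging \<open>A\<close> by a large \<open>k\<close> is invisible in a fixed window and multiplies the wave by
  \<open>-1\<close> at position \<open>2 ^ (k\<^sup>2 - 1)\<close>.
\<close>

lemma orbit_space_not_hereditarily_almost_equicontinuous:
  "\<not> shift.hereditarily_almost_equicontinuous"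
proof -
  define S where "S = {shift j (from_coords (far_obs A)) |j A. finite A}"
  obtain \<eta> where \<eta>: "\<eta> > 0" "\<And>v w k j. dist v w < \<eta> \<Longrightarrow> (k, j) \<in> {(Suc 0, 0)} \<Longrightarrow> cmod (coord v k j - coord w k j) < 1"
    using coords_close_if_dist_small[of "{(Suc 0, 0)}" 1] by auto
  show ?thesis
  proof (rule shift.not_hereditarily_almost_equicontinuousI)
    show "S \<subseteq> orbit_space"
      by (auto simp: S_def intro!: shift.invariant far_point_in_orbit_space)
    show "S \<noteq> {}"
      by (auto simp: S_def)
    show "shift n a \<in> S" if "a \<in> S" for a n
      using that unfolding S_def by clarsimp (metis shift.flow_add)
    show "\<eta> > 0" by (rule \<eta>(1))
  next
    fix a and \<delta> :: real assume "a \<in> S" "\<delta> > 0"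
    then obtain j A where a: "a = shift j (from_coords (far_obs A))" and A: "finite A"
      by (auto simp: S_def)
    obtain P e where P: "finite P" "e > 0"
        "\<And>v w. (\<And>k j. (k, j) \<in> P \<Longrightarrow> cmod (coord v k j - coord w k j) < e) \<Longrightarrow> dist v w < \<delta>"
      using dist_lt_if_coords_close[OF \<open>\<delta> > 0\<close>] by metis
    have small: "\<forall>\<^sub>F k in sequentially. cmod (char_circle k p - 1) < e" for p
    proof -
      have "\<forall>\<^sub>F k in sequentially. seminorm_term k p < e"
        using summable_LIMSEQ_zero[OF seminorm_term_summable] P(2) by (rule order_tendstoD)
      then show ?thesis
      proof eventually_elim
        case (elim k)
        have "1 * cmod (char_circle k p - 1) \<le> seminorm_term k p"
          unfolding seminorm_term_def by (intro mult_right_mono) auto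
        with elim show ?case by simp
      qed
    qed
    have "\<forall>\<^sub>F k in sequentially. (\<forall>p\<in>P. cmod (char_circle k (snd p + j) - 1) < e) \<and> k \<ge> 1 \<and> k > Max (insert 0 A)"
      using P(1) by (intro eventually_conj eventually_ball_finite ballI small eventually_ge_at_top eventually_gt_at_top)
    then obtain k where k: "\<forall>p\<in>P. cmod (char_circle k (snd p + j) - 1) < e" "k \<ge> 1" "k > Max (insert 0 A)"
      using eventually_happens'[OF sequentially_bot] by blast
    have "k \<notin> A"
      using k(3) A by auto
    then have prod: "char_prod (insert k A) p = char_circle k p * char_prod A p" for p
      using A by (simp add: char_prod_def)
    have diff: "cmod (char_prod A p - char_prod (insert k A) p) = cmod (char_circle k p - 1)" for p
    proof -
      have "char_prod A p - char_prod (insert k A) p = char_prod A p * (1 - char_circle k p)"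
        by (simp add: prod ring_distribs mult.commute)
      then show ?thesis
        by (simp add: norm_mult norm_minus_commute)
    qed
    let ?b = "shift j (from_coords (far_obs (insert k A)))"
    show "\<exists>b\<in>S. dist a b < \<delta> \<and> (\<exists>n. \<eta> \<le> dist (shift n a) (shift n b))"
    proof (intro bexI conjI exI)
      show "?b \<in> S"
        using A by (auto simp: S_def)
      show "dist a ?b < \<delta>"
      proof (rule P(3))
        fix i p assume "(i, p) \<in> P"
        then show "cmod (coord a i p - coord ?b i p) < e"
          using k(1) P(2) diff by (cases i rule: obs_cases) (auto simp: a)
      qed
      \<comment> \<open>the shift by \<open>j\<close> has to be undone before going to the position of the sign change\<close>
      let ?n = "2 ^ (k\<^sup>2 - 1) - j"
      have "cmod (coord (shift ?n a) (Suc 0) 0 - coord (shift ?n ?b) (Suc 0) 0) = 2"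
        using k(2) by (simp add: a diff char_half del: One_nat_def)
      then show "\<eta> \<le> dist (shift ?n a) (shift ?n ?b)"
        using \<eta>(2)[of "shift ?n a" "shift ?n ?b" "Suc 0" 0] by force
    qed
  qed
qed

theorem theorem13p1:
  shows "\<exists>(X :: (nat \<Rightarrow> real) set) d T.
           cascade X d T \<and>
           cascade.recurrent_transitive X d T \<and>
           cascade.locally_equicontinuous X d T \<and>
           \<not> cascade.hereditarily_almost_equicontinuous X d T"
  using shift.cascade_axioms orbit_space_recurrent_transitive orbit_space_locally_equicontinuous
    orbit_space_not_hereditarily_almost_equicontinuous
  by blast

end
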